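(* Consider a dynamical-decoupling (DD) protected gate of duration $t_0$ at a circuit location, built from $N$ pulses of width $\delta$, with toggling-frame Hamiltonian $\tilde H(t)=H_B+\tilde H_{\rm err}(t)$, $t\in[0,t_0]$, as described in the context, where $\|H_B\|\le\beta$, $\|H_{\rm err}\|\le J$, $\epsilon=\beta+J$. Assume the memory sequence achieves first-order decoupling in the ideal (zero-width) limit in the sense of the context. Put $T=t_0$, let $\Omega_n(T)$ be the Magnus terms of $H_M(t)=\tilde H(t)$ on $[0,T]$, and let $\Omega_1'(T)=\Omega_1(T)+iTH_B$. Then $$\|\Omega_1'(T)\|\le C_1(JT),\qquad \|\Omega_n(T)\|\le C_n(JT)(\epsilon T)^{n-1}\quad(n=2,3,4),$$ with $C_2=\tfrac12$, $C_3=\tfrac29$, $C_4=\tfrac{11}{9}$, and $C_1=2N\delta/T$ in general, while one may take $C_1=N\delta/T$ if the pulses are regularly spaced in time. If moreover $\epsilon T\le 0.54$, then $$\sum_{n=5}^\infty\|\Omega_n(T)\|\le C_5(JT)(\epsilon T)^4,\qquad C_5=9.43,$$ and the effective noise strength $\eta_{\rm DD}=\|\tilde U(t_0,0)-e^{-it_0H_B}\|$ satisfies $$\eta_{\rm DD}\le (JT)\sum_{n=1}^5C_n(\epsilon T)^{n-1}.$$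
   Context: All operators are bounded, on $\mathcal H_S\otimes\mathcal H_B$ (system $\otimes$ bath); $\|\cdot\|$ is the operator norm. The noise Hamiltonian is the time-independent Hermitian operator $H=H_B+H_{\rm err}$ with $H_B=\mathbb I_S\otimes B_0$. (Local-bath assumption: each circuit location has its own $H$, acting on its own qubits and its own bath, so each location is treated separately; $\beta,J$ may be taken as maxima over all locations, and then the bound on $\eta_{\rm DD}$ holds for the maximum over locations.) Control: $U_c(t)$, $t\in[0,t_0]$, is a continuous, piecewise smooth family of unitaries acting on the system only, $U_c(0)=\mathbb I$, constant outside the pulse intervals $[s_k,s_k+\delta)$, $k=1,\dots,N$, where $0\le s_1$, $s_k+\delta\le s_{k+1}$, and $s_N+\delta=t_0$. For $k<N$ the $k$th pulse implements the unitary $P_k$, so $U_c(t)=V_k:=P_k\cdots P_1$ for $t\in[s_k+\delta,s_{k+1}]$, and $U_c=V_0=\mathbb I$ on $[0,s_1]$. The last pulse implements $GP_N$, where $G$ is the ideal gate and $P_N$ (possibly $P_N=\mathbb I$, when the gate pulse is appended to the memory sequence) is the last pulse of the memory sequence; the memory sequence is cyclic, $V_N:=P_N\cdots P_1=\mathbb I$ up to a phase. Toggling frame: $\tilde H(t)=U_c^\dagger(t)HU_c(t)=H_B+\tilde H_{\rm err}(t)$ with $\tilde H_{\rm err}(t)=U_c^\dagger(t)H_{\rm err}U_c(t)$; $\tilde U(t,0)$ solves $\frac{d}{dt}\tilde U=-i\tilde H(t)\tilde U$, $\tilde U(0,0)=\mathbb I$. Ideal (zero-width) reference: $\tilde H_{{\rm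 err},0}(t)=\tilde H_{\rm err}^{(k)}:=V_k^\dagger H_{\rm err}V_k$ for $t\in[s_k,s_{k+1})$, $1\le k<N$, $\tilde H_{{\rm err},0}=\tilde H_{\rm err}^{(0)}=H_{\rm err}$ on $[0,s_1)$, and $\tilde H_{{\rm err},0}=\tilde H_{\rm err}^{(N)}=H_{\rm err}$ on $[s_N,t_0]$. First-order decoupling means $\int_0^{t_0}\tilde H_{{\rm err},0}(t)\,dt=0$. "Regularly spaced" means that $s_{k+1}-s_k$ has the same value for all $k=1,\dots,N$, where cyclically $s_{N+1}:=t_0+s_1$. Magnus terms of a bounded Hermitian piecewise continuous $H_M(t)$: with $A(t)=-iH_M(t)$ and Bernoulli numbers $B_j$ defined by $x/(e^x-1)=\sum_j\frac{B_j}{j!}x^j$, $\Omega_1(t)=\int_0^tA(s)ds$; for $n\ge2$, $\Omega_n(t)=\sum_{j=1}^{n-1}\frac{B_j}{j!}\int_0^tS_n^{(j)}(s)ds$, where $S_n^{(1)}(t)=[\Omega_{n-1}(t),A(t)]$ and $S_n^{(j)}(t)=\sum_{m=1}^{n-j}[\Omega_m(t),S_{n-m}^{(j-1)}(t)]$ for $2\le j\le n-1$. When the series converges, $\exp(\sum_n\Omega_n(T))$ is the time evolution operator on $[0,T]$ generated by $H_M$. *)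

theory Defs
  imports
    "HOL-Analysis.Analysis"
    "HOL-Computational_Algebra.Formal_Power_Series"
begin

section \<open>Complex Hilbert spaces\<close>

class complex_vector = real_vector +
  fixes scaleC :: "complex \<Rightarrow> 'a \<Rightarrow> 'a" (infixr "*\<^sub>C" 75)
  assumes scaleC_add_right: "c *\<^sub>C (x + y) = c *\<^sub>C x + c *\<^sub>C y"
    and scaleC_add_left: "(c + d) *\<^sub>C x = c *\<^sub>C x + d *\<^sub>C x"
    and scaleC_scaleC: "c *\<^sub>C d *\<^sub>C x = (c * d) *\<^sub>C x"
    and scaleC_one: "1 *\<^sub>C x = x"
    and scaleR_scaleC: "r *\<^sub>R x = complex_of_real r *\<^sub>C x"

text \<open>
  The inner product is antilinear in the first and linear in the second argument.
  The zero space is excluded, so that the bounded operators form a normed algebra with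
  \<open>norm 1 = 1\<close> and the library exponential is available for them.
\<close>

class hilbert_space = complex_vector + banach +
  fixes cinner :: "'a \<Rightarrow> 'a \<Rightarrow> complex"
  assumes cinner_commute: "cinner x y = cnj (cinner y x)"
    and cinner_add_right: "cinner x (y + z) = cinner x y + cinner x z"
    and cinner_scaleC_right: "cinner x (c *\<^sub>C y) = c * cinner x y"
    and cinner_norm: "cinner x x = complex_of_real ((norm x)\<^sup>2)"
    and ex_nonzero: "\<exists>x. x \<noteq> 0"

lemma cinner_add_left: "cinner (x + y) z = cinner x z + cinner y z"
  for x y z :: "'a::hilbert_space"
  by (metis cinner_commute cinner_add_right complex_cnj_add)

lemma cinner_scaleC_left: "cinner (c *\<^sub>C x) y = cnj c * cinner x y"
  for x y :: "'a::hilbert_space"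
  by (metis cinner_commute cinner_scaleC_right complex_cnj_mult)

lemma norm_scaleC: "norm (c *\<^sub>C x) = cmod c * norm x" for x :: "'a::hilbert_space"
proof -
  have "complex_of_real ((norm (c *\<^sub>C x))\<^sup>2) = cnj c * (c * complex_of_real ((norm x)\<^sup>2))"
    by (metis cinner_norm cinner_scaleC_left cinner_scaleC_right)
  also have "\<dots> = complex_of_real ((cmod c * norm x)\<^sup>2)"
    using complex_norm_square[of c]
    by (simp add: power_mult_distrib mult.assoc[symmetric] mult.commute)
  finally have "(norm (c *\<^sub>C x))\<^sup>2 = (cmod c * norm x)\<^sup>2"
    using of_real_eq_iff by blast
  then show ?thesis by (simp add: power2_eq_iff_nonneg)
qed

lemma bounded_linear_scaleC: "bounded_linear (\<lambda>x :: 'a::hilbert_space. c *\<^sub>C x)"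
proof (rule bounded_linear_intro[where K = "cmod c"])
  fix x y :: 'a and r :: real
  show "c *\<^sub>C (x + y) = c *\<^sub>C x + c *\<^sub>C y" by (rule scaleC_add_right)
  show "c *\<^sub>C r *\<^sub>R x = r *\<^sub>R c *\<^sub>C x"
    by (simp add: scaleR_scaleC scaleC_scaleC mult.commute)
  show "norm (c *\<^sub>C x) \<le> norm x * cmod c" by (simp add: norm_scaleC mult.commute)
qed

lemma scaleC_diff_right: "c *\<^sub>C (x - y) = c *\<^sub>C x - c *\<^sub>C y" for x y :: "'a::hilbert_space"
  by (rule linear_diff[OF bounded_linear.linear[OF bounded_linear_scaleC]])

lemma scaleC_minus_right: "c *\<^sub>C (- x) = - (c *\<^sub>C x)" for x :: "'a::hilbert_space"
  by (rule linear_neg[OF bounded_linear.linear[OF bounded_linear_scaleC]])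

lemma scaleC_zero_right: "c *\<^sub>C 0 = (0 :: 'a::hilbert_space)"
  by (rule linear_0[OF bounded_linear.linear[OF bounded_linear_scaleC]])

lemma scaleC_scaleR_commute: "c *\<^sub>C r *\<^sub>R x = r *\<^sub>R c *\<^sub>C x" for x :: "'a::complex_vector"
  by (simp add: scaleR_scaleC scaleC_scaleC mult.commute)

lemma cinner_ext: "x = y" if "\<And>z. cinner z x = cinner z y" for x y :: "'a::hilbert_space"
proof -
  have "cinner (x - y) (x - y) + cinner (x - y) y = cinner (x - y) x"
    by (simp flip: cinner_add_right)
  then have "cinner (x - y) (x - y) = 0" using that by simp
  then show ?thesis by (simp add: cinner_norm)
qed

section \<open>The algebra of bounded operators\<close>

typedef (overloaded) 'a bop =
  "{A :: 'a::hilbert_space \<Rightarrow>\<^sub>L 'a.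
     \<forall>c x. blinfun_apply A (c *\<^sub>C x) = c *\<^sub>C blinfun_apply A x}"
  by (rule exI[of _ 0]) (simp add: scaleC_zero_right)

setup_lifting type_definition_bop

lift_definition bop_apply :: "'a::hilbert_space bop \<Rightarrow> 'a \<Rightarrow> 'a" (infixr "*\<^sub>V" 70)
  is blinfun_apply .

lemma bop_eqI: "A = B" if "\<And>x. A *\<^sub>V x = B *\<^sub>V x"
  using that by transfer (rule blinfun_eqI)

lemma bounded_linear_bop_apply: "bounded_linear (bop_apply A)"
  by transfer (rule blinfun.bounded_linear_right)

lemma bop_apply_scaleC: "A *\<^sub>V (c *\<^sub>C x) = c *\<^sub>C (A *\<^sub>V x)"
  by transfer blast

instantiation bop :: (hilbert_space) "{complex_vector, real_normed_vector}"
begin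

lift_definition zero_bop :: "'a bop" is 0
  by (simp add: scaleC_zero_right)

lift_definition plus_bop :: "'a bop \<Rightarrow> 'a bop \<Rightarrow> 'a bop" is "(+)"
  by (simp add: blinfun.add_left scaleC_add_right)

lift_definition minus_bop :: "'a bop \<Rightarrow> 'a bop \<Rightarrow> 'a bop" is "(-)"
  by (simp add: blinfun.diff_left scaleC_diff_right)

lift_definition uminus_bop :: "'a bop \<Rightarrow> 'a bop" is uminus
  by (simp add: blinfun.minus_left scaleC_minus_right)

lift_definition scaleR_bop :: "real \<Rightarrow> 'a bop \<Rightarrow> 'a bop" is scaleR
  by (simp add: blinfun.scaleR_left scaleC_scaleR_commute)

lift_definition scaleC_bop :: "complex \<Rightarrow> 'a bop \<Rightarrow> 'a bop"
  is "\<lambda>c A. Blinfun (\<lambda>x. c *\<^sub>C x) o\<^sub>L A"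
  by (simp add: bounded_linear_Blinfun_apply[OF bounded_linear_scaleC] scaleC_scaleC mult.commute)

lift_definition norm_bop :: "'a bop \<Rightarrow> real" is norm .

definition dist_bop :: "'a bop \<Rightarrow> 'a bop \<Rightarrow> real"
  where "dist_bop A B = norm (A - B)"

definition sgn_bop :: "'a bop \<Rightarrow> 'a bop"
  where "sgn_bop A = inverse (norm A) *\<^sub>R A"

definition uniformity_bop :: "('a bop \<times> 'a bop) filter"
  where "uniformity_bop = (INF e\<in>{0<..}. principal {(x, y). dist x y < e})"

definition open_bop :: "'a bop set \<Rightarrow> bool"
  where "open_bop S = (\<forall>x\<in>S. \<forall>\<^sub>F (x', y) in uniformity. x' = x \<longrightarrow> y \<in> S)"

lemma blinfun_scaleC_apply: "blinfun_apply (Blinfun (\<lambda>x::'a. c *\<^sub>C x)) x = c *\<^sub>C x"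
  by (simp add: bounded_linear_Blinfun_apply[OF bounded_linear_scaleC])

instance
proof
  fix A B C :: "'a bop" and c d :: complex and r s :: real
  show "A + B + C = A + (B + C)" by transfer (rule add.assoc)
  show "A + B = B + A" by transfer (rule add.commute)
  show "0 + A = A" by transfer simp
  show "- A + A = 0" by transfer simp
  show "A - B = A + - B" by transfer simp
  show "r *\<^sub>R (A + B) = r *\<^sub>R A + r *\<^sub>R B" by transfer (rule scaleR_add_right)
  show "(r + s) *\<^sub>R A = r *\<^sub>R A + s *\<^sub>R A" by transfer (rule scaleR_add_left)
  show "r *\<^sub>R s *\<^sub>R A = (r * s) *\<^sub>R A" by transfer simp
  show "1 *\<^sub>R A = A" by transfer simp
  show "c *\<^sub>C (A + B) = c *\<^sub>C A + c *\<^sub>C B"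
    by transfer (auto intro!: blinfun_eqI
        simp: blinfun_scaleC_apply blinfun.add_left scaleC_add_right)
  show "(c + d) *\<^sub>C A = c *\<^sub>C A + d *\<^sub>C A"
    by transfer (auto intro!: blinfun_eqI
        simp: blinfun_scaleC_apply blinfun.add_left scaleC_add_left)
  show "c *\<^sub>C d *\<^sub>C A = (c * d) *\<^sub>C A"
    by transfer (auto intro!: blinfun_eqI simp: blinfun_scaleC_apply scaleC_scaleC)
  show "1 *\<^sub>C A = A"
    by transfer (auto intro!: blinfun_eqI simp: blinfun_scaleC_apply scaleC_one)
  show "r *\<^sub>R A = complex_of_real r *\<^sub>C A"
    by transfer (auto intro!: blinfun_eqI
        simp: blinfun_scaleC_apply blinfun.scaleR_left scaleR_scaleC)
  show "dist A B = norm (A - B)" by (rule dist_bop_def)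
  show "sgn A = inverse (norm A) *\<^sub>R A" by (rule sgn_bop_def)
  show "uniformity = (INF e\<in>{0<..}. principal {(x, y::'a bop). dist x y < e})"
    by (rule uniformity_bop_def)
  show "open S = (\<forall>x\<in>S. \<forall>\<^sub>F (x', y) in uniformity. x' = x \<longrightarrow> y \<in> S)" for S :: "'a bop set"
    by (rule open_bop_def)
  show "(norm A = 0) = (A = 0)" by transfer simp
  show "norm (A + B) \<le> norm A + norm B" by transfer (rule norm_triangle_ineq)
  show "norm (r *\<^sub>R A) = \<bar>r\<bar> * norm A" by transfer simp
qed

end

instantiation bop :: (hilbert_space) real_normed_algebra_1
begin

lift_definition one_bop :: "'a bop" is id_blinfun
  by simp

lift_definition times_bop :: "'a bop \<Rightarrow> 'a bop \<Rightarrow> 'a bop" is blinfun_compose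
  by simp

instance
proof
  fix A B C :: "'a bop" and r :: real
  show "A * B * C = A * (B * C)" by transfer (auto intro!: blinfun_eqI)
  show "(A + B) * C = A * C + B * C"
    by transfer (auto intro!: blinfun_eqI simp: blinfun.add_left)
  show "A * (B + C) = A * B + A * C"
    by transfer (auto intro!: blinfun_eqI simp: blinfun.add_left blinfun.add_right)
  show "r *\<^sub>R A * B = r *\<^sub>R (A * B)"
    by transfer (auto intro!: blinfun_eqI simp: blinfun.scaleR_left)
  show "A * r *\<^sub>R B = r *\<^sub>R (A * B)"
    by transfer (auto intro!: blinfun_eqI simp: blinfun.scaleR_left blinfun.scaleR_right)
  show "1 * A = A" by transfer (auto intro!: blinfun_eqI)
  show "A * 1 = A" by transfer (auto intro!: blinfun_eqI)
  show "norm (A * B) \<le> norm A * norm B" by transfer (rule norm_blinfun_compose)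
  obtain x :: 'a where x: "x \<noteq> 0" using ex_nonzero by blast
  have le: "1 \<le> norm (id_blinfun :: 'a \<Rightarrow>\<^sub>L 'a)"
    using norm_blinfun[of "id_blinfun :: 'a \<Rightarrow>\<^sub>L 'a" x] x by simp
  then show one: "norm (1 :: 'a bop) = 1"
    by transfer (use norm_blinfun_id_le[where 'a = 'a] in simp)
  then show "(0 :: 'a bop) \<noteq> 1" by (metis norm_zero zero_neq_one)
qed

end

lemma bop_apply_simps [simp]:
  "(0 :: 'a::hilbert_space bop) *\<^sub>V x = 0"
  "(1 :: 'a bop) *\<^sub>V x = x"
  "(A + B) *\<^sub>V x = A *\<^sub>V x + B *\<^sub>V x"
  "(A - B) *\<^sub>V x = A *\<^sub>V x - B *\<^sub>V x"
  "(- A) *\<^sub>V x = - (A *\<^sub>V x)"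
  "(r *\<^sub>R A) *\<^sub>V x = r *\<^sub>R (A *\<^sub>V x)"
  "(c *\<^sub>C A) *\<^sub>V x = c *\<^sub>C (A *\<^sub>V x)"
  "(A * B) *\<^sub>V x = A *\<^sub>V (B *\<^sub>V x)"
  by (transfer; simp add: blinfun.add_left blinfun.diff_left blinfun.minus_left
      blinfun.scaleR_left blinfun_scaleC_apply)+

lemma norm_bop_apply: "norm (A *\<^sub>V x) \<le> norm A * norm x"
  by transfer (rule norm_blinfun)

lemma norm_bop_bound: "norm A \<le> b" if "0 \<le> b" "\<And>x. norm (A *\<^sub>V x) \<le> b * norm x"
  using that by transfer (rule norm_blinfun_bound)

instance bop :: (hilbert_space) banach
proof
  fix X :: "nat \<Rightarrow> 'a bop"
  assume X: "Cauchy X"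
  have dist: "dist (Rep_bop A) (Rep_bop B) = dist A B" for A B :: "'a bop"
    by (simp add: dist_norm norm_bop.rep_eq minus_bop.rep_eq)
  have "Cauchy (\<lambda>n. Rep_bop (X n))"
    using X by (simp add: Cauchy_def dist)
  then obtain L where L: "(\<lambda>n. Rep_bop (X n)) \<longlonglongrightarrow> L"
    using Cauchy_convergent convergent_def by blast
  have lim: "(\<lambda>n. blinfun_apply (Rep_bop (X n)) y) \<longlonglongrightarrow> blinfun_apply L y" for y
    by (intro tendsto_intros L)
  have "blinfun_apply L (c *\<^sub>C x) = c *\<^sub>C blinfun_apply L x" for c x
  proof (rule LIMSEQ_unique)
    show "(\<lambda>n. blinfun_apply (Rep_bop (X n)) (c *\<^sub>C x)) \<longlonglongrightarrow> blinfun_apply L (c *\<^sub>C x)"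
      by (rule lim)
    have eq: "(\<lambda>n. blinfun_apply (Rep_bop (X n)) (c *\<^sub>C x)) =
        (\<lambda>n. c *\<^sub>C blinfun_apply (Rep_bop (X n)) x)"
      by (rule ext) (simp only: bop_apply_scaleC flip: bop_apply.rep_eq)
    show "(\<lambda>n. blinfun_apply (Rep_bop (X n)) (c *\<^sub>C x)) \<longlonglongrightarrow> c *\<^sub>C blinfun_apply L x"
      unfolding eq by (rule bounded_linear.tendsto[OF bounded_linear_scaleC lim])
  qed
  then have "Rep_bop (Abs_bop L) = L" by (simp add: Abs_bop_inverse)
  then have "dist (Rep_bop (X n)) L = dist (X n) (Abs_bop L)" for n
    by (metis dist)
  then have "X \<longlonglongrightarrow> Abs_bop L"
    using L unfolding tendsto_dist_iff[of _ L] tendsto_dist_iff[of X] by (simp only:)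
  then show "convergent X" by (rule convergentI)
qed

text \<open>Existence of the adjoint of an arbitrary bounded operator is the Riesz representation
  theorem; only adjoints of unitaries are used below, see \<open>unitary_adj\<close>.\<close>

definition adj :: "'a::hilbert_space bop \<Rightarrow> 'a bop"
  where "adj A = (THE B. \<forall>x y. cinner (B *\<^sub>V x) y = cinner x (A *\<^sub>V y))"

definition hermitian :: "'a::hilbert_space bop \<Rightarrow> bool"
  where "hermitian A \<longleftrightarrow> (\<forall>x y. cinner (A *\<^sub>V x) y = cinner x (A *\<^sub>V y))"

definition unitary :: "'a::hilbert_space bop \<Rightarrow> bool"
  where "unitary U \<longleftrightarrow>
    (\<forall>x y. cinner (U *\<^sub>V x) (U *\<^sub>V y) = cinner x y) \<and> surj (bop_apply U)"

definition commutator :: "'a::ring \<Rightarrow> 'a \<Rightarrow> 'a"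
  where "commutator A B = A * B - B * A"

lemma adj_eqI: "adj A = B" if "\<And>x y. cinner (B *\<^sub>V x) y = cinner x (A *\<^sub>V y)"
  unfolding adj_def
proof (rule the_equality)
  fix C assume C: "\<forall>x y. cinner (C *\<^sub>V x) y = cinner x (A *\<^sub>V y)"
  show "C = B"
    by (rule bop_eqI, rule cinner_ext) (metis C that cinner_commute)
qed (use that in blast)

lemma unitary_adj:
  assumes "unitary U"
  shows "adj U * U = 1" "U * adj U = 1" "cinner (adj U *\<^sub>V x) y = cinner x (U *\<^sub>V y)"
proof -
  let ?f = "bop_apply U"
  have iso: "cinner (U *\<^sub>V x) (U *\<^sub>V y) = cinner x y" for x y
    using assms by (simp add: unitary_def)
  have norm: "norm (U *\<^sub>V x) = norm x" for x
  proof -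
    have "complex_of_real ((norm (U *\<^sub>V x))\<^sup>2) = complex_of_real ((norm x)\<^sup>2)"
      unfolding cinner_norm[symmetric] by (rule iso)
    then have "(norm (U *\<^sub>V x))\<^sup>2 = (norm x)\<^sup>2" using of_real_eq_iff by blast
    then show ?thesis by (simp add: power2_eq_iff_nonneg)
  qed
  have surj: "surj ?f" using assms by (simp add: unitary_def)
  interpret U: bounded_linear ?f by (rule bounded_linear_bop_apply)
  have inj: "inj ?f"
  proof (rule injI)
    fix x y assume "U *\<^sub>V x = U *\<^sub>V y"
    then have "norm (U *\<^sub>V (x - y)) = 0" by (simp add: U.diff)
    then show "x = y" by (simp add: norm)
  qed
  have fi: "U *\<^sub>V inv ?f x = x" for x using surj by (rule surj_f_inv_f)
  have "bounded_linear (inv ?f)"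
  proof (rule bounded_linear_intro[where K = 1])
    fix x y and r :: real
    show "inv ?f (x + y) = inv ?f x + inv ?f y"
      by (rule injD[OF inj]) (simp add: fi U.add)
    show "inv ?f (r *\<^sub>R x) = r *\<^sub>R inv ?f x"
      by (rule injD[OF inj]) (simp add: fi U.scaleR)
    show "norm (inv ?f x) \<le> norm x * 1"
      using norm[of "inv ?f x"] by (simp add: fi)
  qed
  moreover have "inv ?f (c *\<^sub>C x) = c *\<^sub>C inv ?f x" for c x
    by (rule injD[OF inj]) (simp add: fi bop_apply_scaleC)
  ultimately have "\<exists>W :: 'a bop. \<forall>x. W *\<^sub>V x = inv ?f x"
    by (intro exI[of _ "Abs_bop (Blinfun (inv ?f))"])
      (simp add: bop_apply.rep_eq Abs_bop_inverse bounded_linear_Blinfun_apply)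
  then obtain W where W: "\<And>x. W *\<^sub>V x = inv ?f x" by blast
  have ip: "cinner (W *\<^sub>V x) y = cinner x (U *\<^sub>V y)" for x y
    using iso[of "W *\<^sub>V x" y] by (simp add: W fi)
  have adj: "adj U = W" by (rule adj_eqI) (rule ip)
  show "cinner (adj U *\<^sub>V x) y = cinner x (U *\<^sub>V y)" by (simp add: adj ip)
  show "U * adj U = 1" by (rule bop_eqI) (simp add: adj W fi)
  show "adj U * U = 1" by (rule bop_eqI) (simp add: adj W inv_f_f[OF inj])
qed

section \<open>Tensor products\<close>

text \<open>The Hilbert space tensor product, characterised up to unique isomorphism: a bilinear map
  that multiplies inner products and whose range is total. The real span is the complex one here,
  since \<open>c *\<^sub>C tens x y = tens (c *\<^sub>C x) y\<close>.\<close>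

definition hilbert_tensor ::
    "('s::hilbert_space \<Rightarrow> 'b::hilbert_space \<Rightarrow> 'h::hilbert_space) \<Rightarrow> bool"
  where "hilbert_tensor tens \<longleftrightarrow>
    (\<forall>x x' y. tens (x + x') y = tens x y + tens x' y) \<and>
    (\<forall>x y y'. tens x (y + y') = tens x y + tens x y') \<and>
    (\<forall>c x y. tens (c *\<^sub>C x) y = c *\<^sub>C tens x y) \<and>
    (\<forall>c x y. tens x (c *\<^sub>C y) = c *\<^sub>C tens x y) \<and>
    (\<forall>x x' y y'. cinner (tens x y) (tens x' y') = cinner x x' * cinner y y') \<and>
    closure (span (range (\<lambda>(x, y). tens x y))) = UNIV"

text \<open>\<open>C = A \<otimes> B\<close>\<close>

definition is_op_tensor ::
    "('s::hilbert_space \<Rightarrow> 'b::hilbert_space \<Rightarrow> 'h::hilbert_space) \<Rightarrow>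
      's bop \<Rightarrow> 'b bop \<Rightarrow> 'h bop \<Rightarrow> bool"
  where "is_op_tensor tens A B C \<longleftrightarrow>
    (\<forall>x y. C *\<^sub>V tens x y = tens (A *\<^sub>V x) (B *\<^sub>V y))"

definition acts_on_system ::
    "('s::hilbert_space \<Rightarrow> 'b::hilbert_space \<Rightarrow> 'h::hilbert_space) \<Rightarrow> 'h bop \<Rightarrow> bool"
  where "acts_on_system tens C \<longleftrightarrow> (\<exists>A. is_op_tensor tens A 1 C)"

section \<open>Control, toggling frame, decoupling\<close>

text \<open>\<open>pulse_prod P k = P k * \<dots> * P 1\<close>\<close>

primrec pulse_prod :: "(nat \<Rightarrow> 'a::monoid_mult) \<Rightarrow> nat \<Rightarrow> 'a" where
  "pulse_prod P 0 = 1"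
| "pulse_prod P (Suc k) = P (Suc k) * pulse_prod P k"

text \<open>
  Pulse \<open>k\<close> (for \<open>1 \<le> k \<le> N\<close>) occupies \<open>[s k, s k + \<delta>)\<close>. The last pulse implements
  \<open>G * P N\<close>, so that \<open>Uc t0 = G * P N * \<dots> * P 1\<close>. The control is continuous in operator norm.
\<close>

definition dd_control ::
    "('s::hilbert_space \<Rightarrow> 'b::hilbert_space \<Rightarrow> 'h::hilbert_space) \<Rightarrow>
      nat \<Rightarrow> real \<Rightarrow> real \<Rightarrow> (nat \<Rightarrow> real) \<Rightarrow> (nat \<Rightarrow> 'h bop) \<Rightarrow> 'h bop \<Rightarrow> (real \<Rightarrow> 'h bop) \<Rightarrow> bool"
  where "dd_control tens N \<delta> t0 s P G Uc \<longleftrightarrow>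
    1 \<le> N \<and> 0 < \<delta> \<and> 0 \<le> s 1 \<and> (\<forall>k\<in>{1..<N}. s k + \<delta> \<le> s (Suc k)) \<and> s N + \<delta> = t0 \<and>
    (\<forall>k\<in>{1..N}. unitary (P k) \<and> acts_on_system tens (P k)) \<and>
    unitary G \<and> acts_on_system tens G \<and>
    (\<forall>t\<in>{0..t0}. unitary (Uc t) \<and> acts_on_system tens (Uc t)) \<and>
    Uc piecewise_C1_differentiable_on {0..t0} \<and>
    (\<forall>t\<in>{0..s 1}. Uc t = 1) \<and>
    (\<forall>k\<in>{1..<N}. \<forall>t\<in>{s k + \<delta>..s (Suc k)}. Uc t = pulse_prod P k) \<and>
    Uc t0 = G * pulse_prod P N \<and>
    (\<exists>c. cmod c = 1 \<and> pulse_prod P N = c *\<^sub>C 1)"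

definition conjugate :: "'a::hilbert_space bop \<Rightarrow> 'a bop \<Rightarrow> 'a bop"
  where "conjugate U X = adj U * X * U"

definition toggling :: "(real \<Rightarrow> 'a::hilbert_space bop) \<Rightarrow> 'a bop \<Rightarrow> real \<Rightarrow> 'a bop"
  where "toggling Uc H t = conjugate (Uc t) H"

text \<open>The cardinality is the \<open>k\<close> with \<open>s k \<le> t < s (Suc k)\<close>, where \<open>k = 0\<close> for \<open>t < s 1\<close> and
  \<open>k = N\<close> for \<open>s N \<le> t\<close>.\<close>

definition ideal_err ::
    "nat \<Rightarrow> (nat \<Rightarrow> real) \<Rightarrow> (nat \<Rightarrow> 'a::hilbert_space bop) \<Rightarrow> 'a bop \<Rightarrow> real \<Rightarrow> 'a bop"
  where "ideal_err N s P Herr t =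
    conjugate (pulse_prod P (card {j \<in> {1..N}. s j \<le> t})) Herr"

definition first_order_decoupling ::
    "nat \<Rightarrow> real \<Rightarrow> (nat \<Rightarrow> real) \<Rightarrow> (nat \<Rightarrow> 'a::hilbert_space bop) \<Rightarrow> 'a bop \<Rightarrow> bool"
  where "first_order_decoupling N t0 s P Herr \<longleftrightarrow>
    (ideal_err N s P Herr has_integral 0) {0..t0}"

text \<open>The last spacing is the cyclic one, \<open>s\<^sub>N\<^sub>+\<^sub>1 = t0 + s\<^sub>1\<close>.\<close>

definition regularly_spaced :: "nat \<Rightarrow> real \<Rightarrow> (nat \<Rightarrow> real) \<Rightarrow> bool"
  where "regularly_spaced N t0 s \<longleftrightarrow>
    (\<forall>k\<in>{1..<N}. s (Suc k) - s k = (t0 + s 1) - s N)"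

definition evolution_on ::
    "real \<Rightarrow> (real \<Rightarrow> 'a::hilbert_space bop) \<Rightarrow> (real \<Rightarrow> 'a bop) \<Rightarrow> bool"
  where "evolution_on T H U \<longleftrightarrow> U 0 = 1 \<and>
    (\<forall>t\<in>{0..T}. (U has_vector_derivative ((- \<i>) *\<^sub>C (H t * U t))) (at t within {0..T}))"

section \<open>Magnus terms\<close>

definition bernoulli_number :: "nat \<Rightarrow> real"
  where "bernoulli_number j = fact j * fps_nth (fps_X / (fps_exp 1 - 1)) j"

declare sum.cong [fundef_cong]

text \<open>\<open>magnus A n\<close> is \<open>\<Omega>\<^sub>n\<close> and \<open>magnus_S A n j\<close> is \<open>S\<^sub>n\<^sup>(\<^sup>j\<^sup>)\<close>; values outside
  \<open>n \<ge> 1\<close>, respectively \<open>1 \<le> j \<le> n - 1\<close>, are not used.\<close>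

function (sequential)
  magnus :: "(real \<Rightarrow> 'a::{banach, real_normed_algebra}) \<Rightarrow> nat \<Rightarrow> real \<Rightarrow> 'a" and
  magnus_S :: "(real \<Rightarrow> 'a::{banach, real_normed_algebra}) \<Rightarrow> nat \<Rightarrow> nat \<Rightarrow> real \<Rightarrow> 'a"
where
  "magnus A n = (\<lambda>t.
     if n = 0 then 0
     else if n = 1 then integral {0..t} A
     else (\<Sum>j = 1..n - 1.
       (bernoulli_number j / fact j) *\<^sub>R integral {0..t} (magnus_S A n j)))"
| "magnus_S A n j = (\<lambda>t.
     if n < 2 \<or> j = 0 then 0
     else if j = 1 then commutator (magnus A (n - 1) t) (A t)
     else (\<Sum>m = 1..n - j. commutator (magnus A m t) (magnus_S A (n - m) (j - 1) t)))"
  by pat_completeness auto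
termination
  by (relation "Wellfounded.measure (\<lambda>x. case x of Inl (A, n) \<Rightarrow> 2 * n + 1 | Inr (A, n, j) \<Rightarrow> 2 * n)") auto

declare magnus.simps [simp del] magnus_S.simps [simp del]

section \<open>Constants of the bound\<close>

definition dd_const :: "real \<Rightarrow> nat \<Rightarrow> real"
  where "dd_const C1 n =
    (if n = 1 then C1 else if n = 2 then 1/2 else if n = 3 then 2/9
     else if n = 4 then 11/9 else if n = 5 then 9.43 else 0)"

end

theory Submission
  imports Defs
begin

text \<open>Write the generator in the toggling frame as \<open>A t = B + E t\<close> with \<open>B = - \<i> H\<^sub>B\<close> and
  \<open>\<parallel>E t\<parallel> \<le> J\<close>. The Magnus recursion gives \<open>\<parallel>\<Omega>\<^sub>n t\<parallel> \<le> c\<^sub>n J \<epsilon>\<^sup>n\<^sup>-\<^sup>1 t\<^sup>n\<close> for scalars \<open>c\<^sub>n\<close> that obey a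
  recursion of the same shape, the factor \<open>J\<close> coming from \<open>\<parallel>[\<Omega>\<^sub>1 t, A t]\<parallel> \<le> 4J\<epsilon>t\<close>; this suffices for
  \<open>n \<ge> 4\<close>. The sharper constants for \<open>n = 2, 3\<close> come from integrating by parts. First-order decoupling
  reduces \<open>\<integral>E\<close> to contributions of the pulse intervals. The bound on the effective noise strength
  does not pass through the Magnus series: to second order it is a Duhamel estimate in a rotating
  frame centred at \<open>T / 2\<close>, and it already gives \<open>(JT) (C\<^sub>1 + \<epsilon>T / 2)\<close>.\<close>

section \<open>Bernoulli coefficients\<close>

text \<open>For \<open>E = 0\<close> the generator is constant and every Magnus term beyond the
  first vanishes, so each higher term must contain one factor \<open>J\<close>. It is enough to
  exhibit this factor in the innermost bracket; all outer brackets can be estimated crudely by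
  powers of \<epsilon>. Summing the scalar recursion over all orders requires the series of |B_j|/j!
  at twice a bound for the generating function of the c_n. This is where 23/20 and 23/10 come from:
  at x = 27/50 one has x + x^2 + 2x^3 <= 23/20, and the Bernoulli series from j = 2 on is at most
  1/2 at 23/10. Both series are controlled through quadratic recursions whose partial sums reproduce
  their own bound, so no convergence statement is required beforehand. In order three the
  contribution cubic in \<open>E\<close> alone already amounts to 2/9. The integration by parts
  therefore has to push the terms containing \<open>B\<close> below the corresponding coefficients
  of 2/9 (\<beta> + J)^2, which is why it is carried through two nested brackets.\<close>

definition bern_coeff :: "nat \<Rightarrow> real"
  where "bern_coeff j = bernoulli_number j / fact j"

lemma bern_fps_mult:
  "(fps_X / (fps_exp 1 - 1)) * (fps_exp 1 - 1) = (fps_X :: real fps)"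
proof -
  have "subdegree (fps_exp 1 - 1 :: real fps) = 1" by (rule subdegreeI) auto
  moreover from this have "(fps_exp 1 - 1 :: real fps) \<noteq> 0" by auto
  ultimately show ?thesis by (subst fps_times_divide_eq) auto
qed

text \<open>Coefficients of the Riccati equation X f' + X f + f^2 = f for f = X/(e^X - 1). It
  results from differentiating f E = X with E = e^X - 1, multiplying by X and cancelling E.\<close>

lemma bern_coeff_conv:
  assumes "n \<noteq> 1"
  shows "(real n - 1) * bern_coeff n
    = - (if n = 0 then 0 else bern_coeff (n - 1)) - (\<Sum>k\<le>n. bern_coeff k * bern_coeff (n - k))"
proof -
  define f :: "real fps" where "f = fps_X / (fps_exp 1 - 1)"
  define E :: "real fps" where "E = fps_exp 1 - 1"
  have fE: "f * E = fps_X" using bern_fps_mult by (simp add: f_def E_def)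
  then have "E \<noteq> 0" by auto
  have dE: "fps_deriv E = E + 1" by (simp add: E_def)
  have "fps_deriv (f * E) = 1" by (simp add: fE)
  then have "fps_deriv f * E + f * (E + 1) = 1" by (simp add: dE algebra_simps)
  then have "fps_X * (fps_deriv f * E + f * (E + 1)) = f * E" by (simp add: fE)
  moreover have "fps_X * (fps_deriv f * E + f * (E + 1))
      = (fps_X * fps_deriv f + fps_X * f) * E + f * (f * E)"
    unfolding fE by (simp add: algebra_simps)
  ultimately have "(fps_X * fps_deriv f + fps_X * f + f * f) * E = f * E"
    by (simp add: algebra_simps)
  then have "fps_X * fps_deriv f + fps_X * f + f * f = f"
    using \<open>E \<noteq> 0\<close> by (simp only: mult_cancel_right) simp
  then have "fps_nth (fps_X * fps_deriv f + fps_X * f + f * f) n = fps_nth f n" by simp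
  moreover have "fps_nth f k = bern_coeff k" for k
    by (simp add: f_def bern_coeff_def bernoulli_number_def)
  ultimately show ?thesis
    by (auto simp: fps_mult_nth[of f f] atMost_atLeast0 algebra_simps)
qed

lemma bern_coeff_0 [simp]: "bern_coeff 0 = 1"
proof -
  have "fps_nth ((fps_X / (fps_exp 1 - 1)) * (fps_exp 1 - 1)) 1 = (1::real)"
    by (simp only: bern_fps_mult) simp
  then show ?thesis by (simp add: fps_mult_nth bern_coeff_def bernoulli_number_def)
qed

lemma bern_coeff_1 [simp]: "bern_coeff (Suc 0) = - 1/2"
proof -
  have "fps_nth ((fps_X / (fps_exp 1 - 1)) * (fps_exp 1 - 1)) 2 = (0::real)"
    by (simp only: bern_fps_mult) simp
  then show ?thesis
    using bern_coeff_0
    by (simp add: fps_mult_nth bern_coeff_def bernoulli_number_def numeral_2_eq_2)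
qed

lemma bern_coeff_2 [simp]: "bern_coeff 2 = 1/12"
  using bern_coeff_conv[of 2] by (simp add: numeral_2_eq_2)

text \<open>Euler's quadratic recursion. In the convolution the indices 0 and \<open>n\<close>
  contribute 2 b_n, which moves to the left, and the indices 1 and \<open>n - 1\<close> contribute
  -b_(n-1), which cancels the linear term.\<close>

lemma bern_coeff_rec:
  assumes "n \<ge> 3"
  shows "(real n + 1) * bern_coeff n = - (\<Sum>k=2..n-2. bern_coeff k * bern_coeff (n - k))"
proof -
  let ?g = "\<lambda>k. bern_coeff k * bern_coeff (n - k)"
  have "{..n} = {0, 1, n - 1, n} \<union> {2..n-2}" using assms by auto
  then have "(\<Sum>k\<le>n. ?g k) = (\<Sum>k\<in>{0, 1, n - 1, n}. ?g k) + (\<Sum>k=2..n-2. ?g k)"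
    by (simp only:) (rule sum.union_disjoint; use assms in auto)
  also have "(\<Sum>k\<in>{0, 1, n - 1, n}. ?g k) = 2 * bern_coeff n - bern_coeff (n - 1)"
  proof -
    have "n - 1 \<noteq> 0" "n - 1 \<noteq> 1" "n \<noteq> 0" "n \<noteq> 1" "n - 1 \<noteq> n" "n - (n - 1) = 1"
      using assms by auto
    then show ?thesis by (simp del: diff_is_0_eq One_nat_def add: bern_coeff_1[folded One_nat_def])
  qed
  finally have "(real n - 1) * bern_coeff n = - 2 * bern_coeff n
      - (\<Sum>k=2..n-2. bern_coeff k * bern_coeff (n - k))"
    using bern_coeff_conv[of n] assms by simp
  then show ?thesis by (simp add: left_diff_distrib distrib_right)
qed

lemma bern_coeff_3 [simp]: "bern_coeff 3 = 0"
  using bern_coeff_rec[of 3] by simp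

text \<open>Both sequences vanish at 0, so in total degree at most \<open>N + 1\<close> each index
  is at most \<open>N\<close>. This gain of one lets inductions on the truncation order
  close.\<close>

lemma sum_convolution_le:
  fixes a b :: "nat \<Rightarrow> real"
  assumes "\<And>n. a n \<ge> 0" "\<And>n. b n \<ge> 0" "a 0 = 0" "b 0 = 0"
  shows "(\<Sum>n\<le>Suc N. \<Sum>k\<le>n. a k * b (n - k)) \<le> (\<Sum>k\<le>N. a k) * (\<Sum>k\<le>N. b k)"
proof -
  let ?D = "{(k,l). k + l \<le> Suc N}"
  have fin: "finite ?D" by (rule finite_subset[of _ "{..Suc N} \<times> {..Suc N}"]) auto
  have "(\<Sum>n\<le>Suc N. \<Sum>k\<le>n. a k * b (n - k)) = (\<Sum>(k,l)\<in>?D. a k * b l)"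
    by (rule sum.triangle_reindex_eq[symmetric])
  also have "\<dots> = (\<Sum>(k,l)\<in>?D \<inter> {(k,l). k \<noteq> 0 \<and> l \<noteq> 0}. a k * b l)"
    by (rule sum.mono_neutral_right) (auto simp: fin assms intro!: gr0I)
  also have "\<dots> \<le> (\<Sum>(k,l)\<in>{..N} \<times> {..N}. a k * b l)"
    by (rule sum_mono2) (auto simp: assms)
  also have "\<dots> = (\<Sum>k\<le>N. a k) * (\<Sum>k\<le>N. b k)"
    by (simp add: sum_product sum.cartesian_product)
  finally show ?thesis .
qed

text \<open>By Euler's recursion the partial sums satisfy S_(N+1) <= (23/10)^2/12 + S_N^2/5, where
  the first summand is the term n = 2; the bound 1/2 is preserved because 0.441 + 0.05 <
  1/2.\<close>

lemma bern_coeff_sum_le: "(\<Sum>n=2..N. \<bar>bern_coeff n\<bar> * (23/10) ^ n) \<le> 1/2"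
proof (induction N)
  case 0
  show ?case by simp
next
  case (Suc N)
  define a where "a n = (if n < 2 then 0 else \<bar>bern_coeff n\<bar> * (23/10) ^ n)" for n
  have a0: "a n \<ge> 0" for n by (simp add: a_def)
  \<comment> \<open>The factor 1/5 is 1/(n + 1) at n = 4; for n = 3 the Bernoulli coefficient is
    zero.\<close>
  have a_rec: "a n \<le> 1/5 * (\<Sum>k\<le>n. a k * a (n - k))" if n: "n \<ge> 3" for n
  proof (cases "n = 3")
    case True
    then show ?thesis by (simp add: a_def[of 3] sum_nonneg a0)
  next
    case False
    have "(real n + 1) * \<bar>bern_coeff n\<bar> = \<bar>\<Sum>k=2..n-2. bern_coeff k * bern_coeff (n - k)\<bar>"
      using arg_cong[OF bern_coeff_rec[OF n], of abs] by (simp add: abs_mult)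
    also have "\<dots> \<le> (\<Sum>k=2..n-2. \<bar>bern_coeff k\<bar> * \<bar>bern_coeff (n - k)\<bar>)"
      by (rule order_trans[OF sum_abs]) (simp add: abs_mult)
    finally have "(real n + 1) * \<bar>bern_coeff n\<bar> * (23/10) ^ n
        \<le> (\<Sum>k=2..n-2. \<bar>bern_coeff k\<bar> * \<bar>bern_coeff (n - k)\<bar>) * (23/10) ^ n"
      by (rule mult_right_mono) simp
    also have "\<dots> = (\<Sum>k=2..n-2. a k * a (n - k))"
      unfolding sum_distrib_right
    proof (rule sum.cong)
      fix k assume "k \<in> {2..n-2}"
      then have "(23/10::real) ^ n = (23/10) ^ k * (23/10) ^ (n - k)"
        and "\<not> k < 2" "\<not> n - k < 2" using n by (auto simp flip: power_add)
      then show "\<bar>bern_coeff k\<bar> * \<bar>bern_coeff (n - k)\<bar> * (23/10) ^ n = a k * a (n - k)"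
        by (simp add: a_def)
    qed simp
    also have "\<dots> \<le> (\<Sum>k\<le>n. a k * a (n - k))" by (rule sum_mono2) (auto simp: a0)
    finally have "(real n + 1) * a n \<le> (\<Sum>k\<le>n. a k * a (n - k))"
      using n by (simp add: a_def[of n])
    moreover have "5 * a n \<le> (real n + 1) * a n"
      using n False a0[of n] by (intro mult_right_mono) auto
    ultimately show ?thesis by simp
  qed
  have eq: "(\<Sum>n=2..M. \<bar>bern_coeff n\<bar> * (23/10) ^ n) = (\<Sum>n\<le>M. a n)" for M
    by (rule sum.mono_neutral_cong_left) (auto simp: a_def)
  show ?case
  proof (cases "Suc N < 3")
    case True
    then have "N = 0 \<or> N = 1" by auto
    then show ?thesis by (auto simp: power2_eq_square numeral_2_eq_2[symmetric])
  next
    case False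
    have "{..Suc N} = {..2} \<union> {3..Suc N}" using False by auto
    then have "(\<Sum>n\<le>Suc N. a n) = (\<Sum>n\<le>2. a n) + (\<Sum>n=3..Suc N. a n)"
      by (simp only:) (rule sum.union_disjoint; auto)
    also have "(\<Sum>n\<le>2. a n) = (23/10)^2/12"
      by (simp add: a_def numeral_2_eq_2) (simp add: numeral_2_eq_2[symmetric])
    also have "(\<Sum>n=3..Suc N. a n) \<le> (\<Sum>n=3..Suc N. 1/5 * (\<Sum>k\<le>n. a k * a (n - k)))"
      by (rule sum_mono) (use a_rec in auto)
    also have "\<dots> \<le> (\<Sum>n\<le>Suc N. 1/5 * (\<Sum>k\<le>n. a k * a (n - k)))"
      by (rule sum_mono2) (auto intro!: sum_nonneg a0 mult_nonneg_nonneg)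
    also have "\<dots> \<le> 1/5 * ((\<Sum>n\<le>N. a n) * (\<Sum>n\<le>N. a n))"
      unfolding sum_distrib_left[symmetric]
      by (intro mult_left_mono sum_convolution_le a0) (auto simp: a_def)
    also have "\<dots> \<le> 1/5 * (1/2 * (1/2))"
      using Suc.IH unfolding eq by (intro mult_left_mono mult_mono sum_nonneg a0) auto
    finally show ?thesis unfolding eq by (simp add: power2_eq_square)
  qed
qed

section \<open>Majorants of the Magnus recursion\<close>

text \<open>These are the c_n of the overview together with constants for the nested brackets. The
  value 1 at order one stands for \<epsilon>t, without \<open>J\<close>. The base value 4 belongs to
  [\<Omega>_1, A], where \<open>J\<close> enters; every further bracket costs a factor 2, and the
  division by \<open>n\<close> comes from integrating t^(n-1).\<close>

function (sequential) majorant :: "nat \<Rightarrow> real" and majorant_S :: "nat \<Rightarrow> nat \<Rightarrow> real" where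
  "majorant n =
     (if n = 0 then 0 else if n = 1 then 1
      else (\<Sum>j = 1..n - 1. \<bar>bern_coeff j\<bar> * majorant_S n j) / real n)"
| "majorant_S n j =
     (if n < 2 \<or> j = 0 then 0
      else if j = 1 then (if n = 2 then 4 else 2 * majorant (n - 1))
      else (\<Sum>m = 1..n - j. 2 * majorant m * majorant_S (n - m) (j - 1)))"
  by pat_completeness auto
termination
  by (relation "Wellfounded.measure (\<lambda>x. case x of Inl n \<Rightarrow> 2 * n + 1 | Inr (n, j) \<Rightarrow> 2 * n)") auto

declare majorant.simps [simp del] majorant_S.simps [simp del]

lemma majorant_nonneg: "majorant n \<ge> 0" "majorant_S n j \<ge> 0"
proof (induction n and n j rule: majorant_majorant_S.induct)
  case (1 n)
  then show ?case by (subst majorant.simps) (auto intro!: sum_nonneg divide_nonneg_nonneg mult_nonneg_nonneg)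
next
  case (2 n j)
  then show ?case by (subst majorant_S.simps) (auto intro!: sum_nonneg mult_nonneg_nonneg)
qed

lemma majorant_0 [simp]: "majorant 0 = 0" by (simp add: majorant.simps)

lemma majorant_1 [simp]: "majorant (Suc 0) = 1" by (simp add: majorant.simps)

lemma majorant_S_less_2 [simp]: "n < 2 \<Longrightarrow> majorant_S n j = 0"
  by (simp add: majorant_S.simps)

lemma majorant_S_1: "n \<ge> 3 \<Longrightarrow> majorant_S n (Suc 0) = 2 * majorant (n - 1)"
  by (simp add: majorant_S.simps)

lemma majorant_S_2_1 [simp]: "majorant_S 2 (Suc 0) = 4"
  by (simp add: majorant_S.simps)

lemma majorant_S_rec:
  "j \<ge> 2 \<Longrightarrow> majorant_S n j = (\<Sum>m = 1..n - j. 2 * majorant m * majorant_S (n - m) (j - 1))"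
  by (subst majorant_S.simps) auto

lemma majorant_rec:
  "n \<ge> 2 \<Longrightarrow> real n * majorant n = (\<Sum>j = 1..n - 1. \<bar>bern_coeff j\<bar> * majorant_S n j)"
  by (subst majorant.simps) auto

lemma majorant_2 [simp]: "majorant 2 = 1"
  using majorant_rec[of 2] by simp

lemma majorant_3: "majorant 3 = 5/9"
proof -
  have "{1..3 - Suc 0} = {1, 2}" by auto
  moreover have "majorant_S 3 2 = 8" by (simp add: majorant_S_rec)
  ultimately show ?thesis using majorant_rec[of 3] by (simp add: majorant_S_1)
qed

lemma majorant_4: "majorant 4 = 7/18"
proof -
  have s: "{Suc 0..3} = {1, 2, 3}" "{Suc 0..2} = {1, 2}" by auto
  have "majorant_S 4 2 = 12" by (simp add: majorant_S_rec s majorant_S_1)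
  then show ?thesis using majorant_rec[of 4] by (simp add: majorant_S_1 s majorant_3)
qed

text \<open>The generating function of the majorants is evaluated at the largest admissible
  \<open>\<epsilon>T = 27/50\<close>. Since \<open>1 / n \<le> 1 / 3\<close> for the terms of order \<open>n \<ge> 3\<close>, the recursion turns
  a bound on its partial sums up to \<open>N\<close> into one up to \<open>N + 1\<close>; the resulting fixed point
  inequality holds with room to spare.\<close>

lemma majorant_S_sum_1:
  assumes "N \<ge> 2"
  shows "(\<Sum>n\<le>N. majorant_S n 1 * x ^ (n - 1)) = 2 * x + 2 * (\<Sum>n\<le>N-1. majorant n * x ^ n)"
  using assms
proof (induction N rule: dec_induct)
  case base
  show ?case by (simp add: numeral_2_eq_2) (simp add: numeral_2_eq_2[symmetric])
next
  case (step N)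
  then obtain M where "N = Suc M" by (cases N) auto
  then show ?case using step by (simp add: majorant_S_1 algebra_simps)
qed

text \<open>The exponents fit because n - 1 = m + (n - m - 1), so the recursion in \<open>j\<close>
  is a truncated convolution of two sequences vanishing at 0.\<close>

lemma majorant_S_sum_rec:
  assumes "j \<ge> 2" "x \<ge> 0"
  shows "(\<Sum>n\<le>Suc N. majorant_S n j * x ^ (n - 1))
    \<le> 2 * (\<Sum>n\<le>N. majorant n * x ^ n) * (\<Sum>n\<le>N. majorant_S n (j - 1) * x ^ (n - 1))"
proof -
  define a where "a n = 2 * (majorant n * x ^ n)" for n
  define b where "b n = majorant_S n (j - 1) * x ^ (n - 1)" for n
  have nonneg: "a n \<ge> 0" "b n \<ge> 0" for n
    using assms by (simp_all add: a_def b_def majorant_nonneg)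
  have "majorant_S n j * x ^ (n - 1) \<le> (\<Sum>k\<le>n. a k * b (n - k))" for n
  proof -
    have "majorant_S n j * x ^ (n - 1) = (\<Sum>m = 1..n - j. a m * b (n - m))"
      unfolding majorant_S_rec[OF assms(1)] sum_distrib_right
    proof (rule sum.cong)
      fix m assume "m \<in> {1..n - j}"
      then have "n - 1 = m + (n - m - 1)" using assms(1) by auto
      then have "x ^ (n - 1) = x ^ m * x ^ (n - m - 1)" by (metis power_add)
      then show "2 * majorant m * majorant_S (n - m) (j - 1) * x ^ (n - 1) = a m * b (n - m)"
        by (simp add: a_def b_def)
    qed simp
    also have "\<dots> \<le> (\<Sum>k\<le>n. a k * b (n - k))"
      by (rule sum_mono2) (auto simp: nonneg)
    finally show ?thesis .
  qed
  then have "(\<Sum>n\<le>Suc N. majorant_S n j * x ^ (n - 1)) \<le> (\<Sum>n\<le>Suc N. \<Sum>k\<le>n. a k * b (n - k))"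
    by (intro sum_mono)
  also have "\<dots> \<le> (\<Sum>k\<le>N. a k) * (\<Sum>k\<le>N. b k)"
    by (rule sum_convolution_le) (use nonneg in \<open>simp_all add: a_def b_def\<close>)
  finally show ?thesis by (simp add: a_def b_def sum_distrib_left mult.assoc)
qed

text \<open>Each nesting level contributes a factor 2Y and the innermost bracket 2Y + 2x. The excess
  2x arises because the base value 4 exceeds the generic value \<open>2 * majorant 1\<close> by
  2.\<close>

lemma majorant_S_sum_le:
  assumes "j \<ge> 1" "x \<ge> 0" "N \<ge> 1" and Y: "(\<Sum>n\<le>N. majorant n * x ^ n) \<le> Y"
  shows "(\<Sum>n\<le>Suc N. majorant_S n j * x ^ (n - 1)) \<le> (2 * Y) ^ (j - 1) * (2 * Y + 2 * x)"
  using assms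
proof (induction j arbitrary: N rule: dec_induct)
  case base
  then show ?case using majorant_S_sum_1[of "Suc N" x] by simp
next
  case (step j)
  have mono: "(\<Sum>n\<le>M. majorant n * x ^ n) \<le> (\<Sum>n\<le>N. majorant n * x ^ n)" if "M \<le> N" for M
    by (rule sum_mono2) (use that step.prems in \<open>auto simp: majorant_nonneg\<close>)
  have "Y \<ge> 0"
    using step.prems by (intro order_trans[OF sum_nonneg step.prems(3)]) (auto simp: majorant_nonneg)
  have "(\<Sum>n\<le>N. majorant_S n j * x ^ (n - 1)) \<le> (2 * Y) ^ (j - 1) * (2 * Y + 2 * x)"
  \<comment> \<open>The induction hypothesis is used at \<open>N - 1\<close>, which must be at least
    1. For \<open>N = 1\<close> the sum is zero, as brackets start at order two.\<close>
  proof (cases "N = 1")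
    case True
    then show ?thesis using \<open>Y \<ge> 0\<close> step.prems by simp
  next
    case False
    then obtain M where "N = Suc M" "M \<ge> 1" using step.prems by (cases N) auto
    then show ?thesis using step.IH[of M] step.prems mono[of M] by auto
  qed
  then have "2 * (\<Sum>n\<le>N. majorant n * x ^ n) * (\<Sum>n\<le>N. majorant_S n j * x ^ (n - 1))
      \<le> 2 * Y * ((2 * Y) ^ (j - 1) * (2 * Y + 2 * x))"
    using step.prems \<open>Y \<ge> 0\<close> by (intro mult_mono mult_left_mono) (auto intro!: sum_nonneg simp: majorant_nonneg)
  also have "\<dots> = (2 * Y) ^ j * (2 * Y + 2 * x)"
    using step.hyps by (cases j) auto
  finally show ?case
    using majorant_S_sum_rec[of "Suc j" x N] step by simp
qed

text \<open>Orders one and two are kept exactly. If the rest is at most 2x^3, the full partial sum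
  is at most 23/20, and the recursion then bounds three times the next rest by about 0.73, below
  6x^3, which is about 0.94.\<close>

lemma majorant_tail_aux: "(\<Sum>n=3..N. majorant n * (27/50) ^ n) \<le> 2 * (27/50) ^ 3"
proof (induction N)
  case 0
  show ?case by simp
next
  case (Suc N)
  show ?case
  proof (cases "N < 2")
    case True
    then show ?thesis by simp
  next
    case False
    define x :: real where "x = 27/50"
    have x: "x > 0" by (simp add: x_def)
    have split: "{..N} = {0, 1, 2} \<union> {3..N}" using False by auto
    have "(\<Sum>n\<le>N. majorant n * x ^ n) = x + x\<^sup>2 + (\<Sum>n=3..N. majorant n * x ^ n)"
      unfolding split by (subst sum.union_disjoint) auto
    also have "\<dots> \<le> x + x\<^sup>2 + 2 * x ^ 3" using Suc.IH by (simp add: x_def)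
    also have "\<dots> \<le> 23/20" by (simp add: x_def power2_eq_square power3_eq_cube)
    finally have Y: "(\<Sum>n\<le>N. majorant n * x ^ n) \<le> 23/20" .
    define Z where "Z j = (\<Sum>n=3..Suc N. majorant_S n j * x ^ (n - 1))" for j
    have Z_eq: "(\<Sum>n\<le>Suc N. majorant_S n j * x ^ (n - 1)) = majorant_S 2 j * x + Z j" for j
    proof -
      have split: "{..Suc N} = {0, 1, 2} \<union> {3..Suc N}" using False by auto
      show ?thesis unfolding split Z_def by (subst sum.union_disjoint) auto
    qed
    \<comment> \<open>Removing the order-two term 4x from 2Y + 2x leaves 2Y - 2x; for
      \<open>j >= 2\<close> there is no order-two term.\<close>
    have Z1: "Z 1 \<le> 2 * (23/20) - 2 * x"
      using majorant_S_sum_le[of 1 x N "23/20"] Z_eq[of 1] x Y False by simp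
    have Zj: "Z j \<le> (23/10) ^ (j - 1) * (23/10 + 2 * x)" if "j \<ge> 2" for j
      using majorant_S_sum_le[of j x N "23/20"] Z_eq[of j] x Y False that
      by (simp add: majorant_S_rec[of j 2])
    have "(\<Sum>j=1..N. \<bar>bern_coeff j\<bar> * Z j) = 1/2 * Z 1 + (\<Sum>j=2..N. \<bar>bern_coeff j\<bar> * Z j)"
      using False by (subst sum.atLeast_Suc_atMost) (auto simp: numeral_2_eq_2)
    also have "(\<Sum>j=2..N. \<bar>bern_coeff j\<bar> * Z j)
        \<le> (\<Sum>j=2..N. \<bar>bern_coeff j\<bar> * ((23/10) ^ (j - 1) * (23/10 + 2 * x)))"
      by (intro sum_mono mult_left_mono Zj) auto
    \<comment> \<open>One power of 2Y = 23/10 is restored to obtain the Bernoulli series of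
      \<open>bern_coeff_sum_le\<close>.\<close>
    also have "\<dots> = (\<Sum>j=2..N. \<bar>bern_coeff j\<bar> * (23/10) ^ j) * ((23/10 + 2 * x) / (23/10))"
      unfolding sum_distrib_right
    proof (rule sum.cong)
      fix j assume "j \<in> {2..N}"
      then have "(23/10::real) ^ j = 23/10 * (23/10) ^ (j - 1)" by (cases j) auto
      then show "\<bar>bern_coeff j\<bar> * ((23/10) ^ (j - 1) * (23/10 + 2 * x))
          = \<bar>bern_coeff j\<bar> * (23/10) ^ j * ((23/10 + 2 * x) / (23/10))"
        by (simp only:) simp
    qed simp
    also have "\<dots> \<le> 1/2 * ((23/10 + 2 * x) / (23/10))"
      using x by (intro mult_right_mono bern_coeff_sum_le) auto
    finally have "(\<Sum>j=1..N. \<bar>bern_coeff j\<bar> * Z j)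
        \<le> 1/2 * Z 1 + 1/2 * ((23/10 + 2 * x) / (23/10))"
      by auto
    also have "\<dots> \<le> 1/2 * (2 * (23/20) - 2 * x) + 1/2 * ((23/10 + 2 * x) / (23/10))"
      using Z1 by auto
    finally have Z_sum: "(\<Sum>j=1..N. \<bar>bern_coeff j\<bar> * Z j)
        \<le> 1/2 * (2 * (23/20) - 2 * x) + 1/2 * ((23/10 + 2 * x) / (23/10))" .
    have "3 * (\<Sum>n=3..Suc N. majorant n * x ^ n) \<le> (\<Sum>n=3..Suc N. real n * majorant n * x ^ n)"
      unfolding sum_distrib_left
      by (rule sum_mono) (use x in \<open>auto intro!: mult_right_mono simp: majorant_nonneg simp flip: mult.assoc\<close>)
    also have "\<dots> = (\<Sum>n=3..Suc N. \<Sum>j=1..N. x * (\<bar>bern_coeff j\<bar> * (majorant_S n j * x ^ (n - 1))))"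
    proof (rule sum.cong)
      fix n assume n: "n \<in> {3..Suc N}"
      \<comment> \<open>The range of \<open>j\<close> is extended from \<open>n - 1\<close> to
        \<open>N\<close>; the added majorants are empty sums.\<close>
      have "real n * majorant n = (\<Sum>j = 1..N. \<bar>bern_coeff j\<bar> * majorant_S n j)"
        unfolding majorant_rec[of n] using n
        by (subst majorant_rec) (auto intro!: sum.mono_neutral_left simp: majorant_S_rec)
      moreover have "x ^ n = x * x ^ (n - 1)" using n by (cases n) auto
      ultimately show "real n * majorant n * x ^ n
          = (\<Sum>j=1..N. x * (\<bar>bern_coeff j\<bar> * (majorant_S n j * x ^ (n - 1))))"
        by (simp add: sum_distrib_left sum_distrib_right mult_ac)
    qed simp
    also have "\<dots> = x * (\<Sum>j=1..N. \<bar>bern_coeff j\<bar> * Z j)"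
      unfolding Z_def sum_distrib_left by (rule sum.swap)
    also have "\<dots> \<le> x * (1/2 * (2 * (23/20) - 2 * x) + 1/2 * ((23/10 + 2 * x) / (23/10)))"
      using x by (intro mult_left_mono Z_sum) auto
    also have "\<dots> \<le> 3 * (2 * x ^ 3)" by (simp add: x_def power3_eq_cube)
    finally show ?thesis by (simp add: x_def)
  qed
qed

text \<open>Monotonicity reduces to x = 27/50. Adding orders three and four only enlarges the sum,
  which is therefore at most 2x^3/x^5 = 2/x^2, about 6.86.\<close>

lemma majorant_tail:
  assumes "0 \<le> x" "x \<le> 27/50"
  shows "(\<Sum>n<N. majorant (n + 5) * x ^ n) \<le> 9.43"
proof -
  have "(\<Sum>n<N. majorant (n + 5) * x ^ n) \<le> (\<Sum>n<N. majorant (n + 5) * (27/50) ^ n)"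
    using assms by (intro sum_mono mult_left_mono power_mono) (auto simp: majorant_nonneg)
  also have "\<dots> = (\<Sum>n<N. majorant (n + 5) * (27/50) ^ (n + 5)) / (27/50) ^ 5"
    by (simp add: sum_divide_distrib power_add)
  also have "(\<Sum>n<N. majorant (n + 5) * (27/50) ^ (n + 5)) = (\<Sum>n\<in>{5..<N+5}. majorant n * (27/50) ^ n)"
    by (rule sum.reindex_bij_witness[of _ "\<lambda>n. n - 5" "\<lambda>n. n + 5"]) auto
  also have "\<dots> \<le> (\<Sum>n=3..N+5. majorant n * (27/50) ^ n)"
    by (rule sum_mono2) (auto simp: majorant_nonneg)
  also have "\<dots> \<le> 2 * (27/50) ^ 3" by (rule majorant_tail_aux)
  finally have "(\<Sum>n<N. majorant (n + 5) * x ^ n) \<le> 2 * (27/50) ^ 3 / (27/50) ^ 5"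
    by (simp add: divide_right_mono)
  also have "\<dots> \<le> (9.43 :: real)" by (simp add: eval_nat_numeral)
  finally show ?thesis .
qed

section \<open>Brackets and Magnus terms\<close>

lemma commutator_bilinear:
  fixes A B C :: "'a::real_algebra"
  shows "commutator (A + B) C = commutator A C + commutator B C"
    "commutator A (B + C) = commutator A B + commutator A C"
    "commutator (A - B) C = commutator A C - commutator B C"
    "commutator A (B - C) = commutator A B - commutator A C"
    "commutator (- A) C = - commutator A C"
    "commutator A (- C) = - commutator A C"
    "commutator (r *\<^sub>R A) C = r *\<^sub>R commutator A C"
    "commutator A (r *\<^sub>R C) = r *\<^sub>R commutator A C"
    "commutator A 0 = 0" "commutator 0 A = 0" "commutator A A = 0"
  by (simp_all add: commutator_def algebra_simps)

lemma commutator_swap: "commutator A B = - commutator B A"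
  by (simp add: commutator_def)

text \<open>Oriented so that, for \<open>C = B\<close>, an outer \<open>B\<close> moves into the
  innermost bracket.\<close>

lemma commutator_jacobi:
  "commutator (commutator A B) C = commutator (commutator C B) A - commutator (commutator C A) B"
  by (simp add: commutator_def algebra_simps)

lemma norm_commutator_le:
  fixes A B :: "'a::real_normed_algebra"
  assumes "norm A \<le> a" "norm B \<le> b"
  shows "norm (commutator A B) \<le> 2 * a * b"
proof -
  have "norm (A * B) \<le> a * b" "norm (B * A) \<le> b * a"
    using assms by (auto intro!: order_trans[OF norm_mult_ineq] mult_mono order_trans[OF norm_ge_zero])
  then show ?thesis
    unfolding commutator_def using norm_triangle_ineq4[of "A * B" "B * A"] by (simp add: algebra_simps)
qed

lemma has_vector_derivative_commutator [derivative_intros]: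
  fixes f g :: "real \<Rightarrow> 'a::real_normed_algebra"
  assumes "(f has_vector_derivative f') (at t within S)" "(g has_vector_derivative g') (at t within S)"
  shows "((\<lambda>t. commutator (f t) (g t)) has_vector_derivative
    commutator f' (g t) + commutator (f t) g') (at t within S)"
  unfolding commutator_def
  by (rule has_vector_derivative_eq_rhs)
    (auto intro!: derivative_eq_intros assms simp: algebra_simps)

lemma continuous_on_commutator [continuous_intros]:
  fixes f g :: "'b::topological_space \<Rightarrow> 'a::real_normed_algebra"
  assumes "continuous_on S f" "continuous_on S g"
  shows "continuous_on S (\<lambda>t. commutator (f t) (g t))"
  unfolding commutator_def by (intro continuous_intros assms)

text \<open>Modulo exact derivatives every term on the left can be moved onto the brackets
  \<open>[[B, E], \<sqdot>]\<close>; here \<open>E = e' = - l'\<close> and \<open>p\<close> stands for \<open>T - t\<close>, and the last summand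
  is the derivative.\<close>

lemma third_order_identity:
  fixes B E e l :: "'a::real_algebra" and t p :: real
  shows "commutator (commutator (t *\<^sub>R B + e) (B + E)) (p *\<^sub>R B + l)
      + commutator (commutator (p *\<^sub>R B + l) (B + E)) (t *\<^sub>R B + e)
    = (t * p + t * p - p * p / 2 - t * t / 2) *\<^sub>R commutator (commutator B E) B
      + commutator (commutator B E) ((t + t - p) *\<^sub>R l + (p + p - t) *\<^sub>R e)
      + (commutator (commutator e E) l + commutator (commutator l E) e)
      + (- commutator (commutator B e) l + p *\<^sub>R commutator (commutator B E) l
         - p *\<^sub>R commutator (commutator B e) E
         - (commutator (commutator B l) e - t *\<^sub>R commutator (commutator B E) e
            + t *\<^sub>R commutator (commutator B l) E)
         + (- p *\<^sub>R commutator (commutator B e) B + (p * p / 2) *\<^sub>R commutator (commutator B E) B)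
         - (t *\<^sub>R commutator (commutator B l) B - (t * t / 2) *\<^sub>R commutator (commutator B E) B))"
proof -
  have c: "commutator e B = - commutator B e" "commutator l B = - commutator B l"
    by (rule commutator_swap)+
  have j: "commutator (commutator e E) B
      = commutator (commutator B E) e - commutator (commutator B e) E"
    "commutator (commutator l E) B
      = commutator (commutator B E) l - commutator (commutator B l) E"
    by (rule commutator_jacobi)+
  \<comment> \<open>Doubled coefficients are split into two summands again, so that both sides
    expand into the same terms.\<close>
  have double: "(r * 2) *\<^sub>R X = r *\<^sub>R X + r *\<^sub>R X"
    "(r * (q * 2)) *\<^sub>R X = (r * q) *\<^sub>R X + (r * q) *\<^sub>R X" for r q :: real and X :: 'a
    unfolding mult.assoc[symmetric] by (simp_all only: mult_2_right scaleR_add_left)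
  show ?thesis
    by (simp add: commutator_bilinear c j double algebra_simps)
qed

text \<open>The left side is the integrand of \<Omega>_3 after [\<Omega>_2, A] has been integrated
  by parts, with K = \<Omega>_1(t) and L = \<Omega>_1(T) - \<Omega>_1(t). As \<open>L + K\<close> is
  constant in time and K' = A, the last two brackets form the derivative of [[L + K, K], K]. What
  remains is symmetric in \<open>K\<close> and \<open>L\<close> and is treated by
  \<open>third_order_identity\<close>.\<close>

lemma third_order_identity2:
  fixes K A L :: "'a::real_algebra"
  shows "(1/4) *\<^sub>R commutator (commutator K A) L + (1/12) *\<^sub>R commutator K (commutator K A)
    = (1/6) *\<^sub>R (commutator (commutator K A) L + commutator (commutator L A) K)
      - (1/12) *\<^sub>R (commutator (commutator (L + K) A) K + commutator (commutator (L + K) K) A)"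
proof -
  have lin: "(1/4) *\<^sub>R x + (1/12) *\<^sub>R y = (1/6) *\<^sub>R z - (1/12) *\<^sub>R w"
    if "x + x + x + y = z + z - w" for x y z w :: 'a
  proof -
    have "(3::real) *\<^sub>R x = (1 + 1 + 1 :: real) *\<^sub>R x" by simp
    then have x: "3 *\<^sub>R x = x + x + x" by (simp only: scaleR_add_left scaleR_one)
    have "(1/4) *\<^sub>R x + (1/12) *\<^sub>R y = (1/12) *\<^sub>R (3 *\<^sub>R x + y)"
      unfolding scaleR_add_right by simp
    also have "\<dots> = (1/12) *\<^sub>R (2 *\<^sub>R z - w)"
      unfolding x scaleR_2 using that by simp
    also have "\<dots> = (1/6) *\<^sub>R z - (1/12) *\<^sub>R w"
      unfolding scaleR_diff_right by simp
    finally show ?thesis .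
  qed
  show ?thesis by (rule lin) (simp add: commutator_def algebra_simps)
qed

section \<open>Integrals of the weights produced by integration by parts\<close>

lemma has_real_derivative_mult_abs:
  "((\<lambda>u. u * \<bar>u\<bar>) has_real_derivative 2 * \<bar>x\<bar>) (at x)"
proof -
  consider "x > 0" | "x < 0" | "x = 0" by linarith
  then show ?thesis
  proof cases
    case 1
    have "((\<lambda>u. u * u) has_real_derivative 2 * \<bar>x\<bar>) (at x)"
      using 1 by (auto intro!: derivative_eq_intros)
    then show ?thesis
      by (rule has_field_derivative_transform_within_open[of _ _ _ "{0<..}"]) (use 1 in auto)
  next
    case 2
    have "((\<lambda>u. - (u * u)) has_real_derivative 2 * \<bar>x\<bar>) (at x)"
      using 2 by (auto intro!: derivative_eq_intros)
    then show ?thesis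
      by (rule has_field_derivative_transform_within_open[of _ _ _ "{..<0}"]) (use 2 in auto)
  next
    case 3
    have "((\<lambda>h::real. \<bar>h\<bar>) \<longlongrightarrow> \<bar>0\<bar>) (at 0)" by (intro tendsto_intros)
    moreover have "eventually (\<lambda>h::real. h * \<bar>h\<bar> / h = \<bar>h\<bar>) (at 0)"
      by (simp add: eventually_at_filter)
    ultimately have "((\<lambda>h::real. h * \<bar>h\<bar> / h) \<longlongrightarrow> 0) (at 0)"
      by (simp add: tendsto_cong)
    then show ?thesis using 3 by (simp add: DERIV_def)
  qed
qed

lemma has_integral_real_antideriv:
  fixes F f :: "real \<Rightarrow> real"
  assumes "0 \<le> T" "\<And>t. (F has_real_derivative f t) (at t)"
  shows "(f has_integral (F T - F 0)) {0..T}"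
  by (rule fundamental_theorem_of_calculus)
    (use assms in \<open>auto simp: has_real_derivative_iff_has_vector_derivative[symmetric]
      intro: has_field_derivative_at_within\<close>)

text \<open>The first weight occurs in order two and in the comparison of the evolutions, the other
  two in the mixed terms of order three. Since u|u| is differentiable everywhere, no interval has to
  be split; for instance u = 3t - T turns the second weight into |u|(2T - u)/3.\<close>

lemma has_integral_abs_moments:
  fixes T :: real
  assumes "0 \<le> T"
  shows "((\<lambda>t. \<bar>2 * t - T\<bar>) has_integral T\<^sup>2 / 2) {0..T}"
    and "((\<lambda>t. \<bar>3 * t - T\<bar> * (T - t)) has_integral 8/27 * T ^ 3) {0..T}"
    and "((\<lambda>t. \<bar>2 * T - 3 * t\<bar> * t) has_integral 8/27 * T ^ 3) {0..T}"
proof -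
  define m :: "real \<Rightarrow> real" where "m u = u * \<bar>u\<bar>" for u
  have "(m has_real_derivative 2 * \<bar>x\<bar>) (at x)" for x
    using has_real_derivative_mult_abs unfolding m_def[abs_def] .
  note [derivative_intros] = DERIV_chain2[OF this]
  have "((\<lambda>t. m (2 * t - T) / 4) has_real_derivative \<bar>2 * t - T\<bar>) (at t)" for t
    by (rule derivative_eq_intros refl | simp)+
  from has_integral_real_antideriv[OF assms this]
  show "((\<lambda>t. \<bar>2 * t - T\<bar>) has_integral T\<^sup>2 / 2) {0..T}"
    using assms by (simp add: m_def power2_eq_square)
  have "((\<lambda>t. T * m (3 * t - T) / 9 - (3 * t - T) * m (3 * t - T) / 27)
      has_real_derivative \<bar>3 * t - T\<bar> * (T - t)) (at t)" for t
    by (rule derivative_eq_intros refl | simp)+ (simp add: m_def field_simps)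
  from has_integral_real_antideriv[OF assms this]
  show "((\<lambda>t. \<bar>3 * t - T\<bar> * (T - t)) has_integral 8/27 * T ^ 3) {0..T}"
    using assms by (simp add: m_def power3_eq_cube mult.assoc)
  have "((\<lambda>t. T * m (3 * t - 2 * T) / 9 + (3 * t - 2 * T) * m (3 * t - 2 * T) / 27)
      has_real_derivative \<bar>2 * T - 3 * t\<bar> * t) (at t)" for t
    unfolding abs_minus_commute[of "2 * T" "3 * t"]
    by (rule derivative_eq_intros refl | simp)+ (simp add: m_def field_simps)
  from has_integral_real_antideriv[OF assms this]
  show "((\<lambda>t. \<bar>2 * T - 3 * t\<bar> * t) has_integral 8/27 * T ^ 3) {0..T}"
    using assms by (simp add: m_def power3_eq_cube mult.assoc)
qed

lemma has_integral_norm_le: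
  fixes f :: "real \<Rightarrow> 'a::banach"
  assumes "(f has_integral I) {0..T}" "(g has_integral G) {0..T}"
    and "\<And>t. t \<in> {0..T} \<Longrightarrow> norm (f t) \<le> g t"
  shows "norm I \<le> G"
  using Henstock_Kurzweil_Integration.integral_norm_bound_integral
    [OF has_integral_integrable[OF assms(1)] has_integral_integrable[OF assms(2)] assms(3)]
  by (simp add: integral_unique[OF assms(1)] integral_unique[OF assms(2)])

text \<open>The factors -\<i> are absorbed into \<open>A\<close>, \<open>B\<close> and
  \<open>E\<close>, so the Magnus estimates take place in a real Banach algebra. Skewness enters
  only when evolutions are compared.\<close>

locale perturbed_generator =
  fixes A E :: "real \<Rightarrow> 'a::{banach, real_normed_algebra}" and B :: 'a and T \<beta> J :: real
  assumes T_nonneg: "0 \<le> T"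
    and A_eq: "\<And>t. t \<in> {0..T} \<Longrightarrow> A t = B + E t"
    and E_cont: "continuous_on {0..T} E"
    and B_norm: "norm B \<le> \<beta>"
    and E_norm: "\<And>t. t \<in> {0..T} \<Longrightarrow> norm (E t) \<le> J"
begin

section \<open>Continuity and recursive bounds of the Magnus terms\<close>

lemma \<beta>_nonneg: "0 \<le> \<beta>" by (rule order_trans[OF norm_ge_zero B_norm])

lemma J_nonneg: "0 \<le> J" by (rule order_trans[OF norm_ge_zero E_norm[of 0]]) (simp add: T_nonneg)

lemma A_norm: "t \<in> {0..T} \<Longrightarrow> norm (A t) \<le> \<beta> + J"
  using add_mono[OF B_norm E_norm[of t]] by (simp add: A_eq order_trans[OF norm_triangle_ineq])

lemma A_cont: "continuous_on {0..T} A"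
  using E_cont by (subst continuous_on_cong[OF refl A_eq]) (auto intro!: continuous_intros)

lemma magnus_1: "magnus A (Suc 0) t = integral {0..t} A"
  by (simp add: magnus.simps)

lemma magnus_rec: "n \<ge> 2 \<Longrightarrow>
    magnus A n t = (\<Sum>j = 1..n - 1. bern_coeff j *\<^sub>R integral {0..t} (magnus_S A n j))"
  by (subst magnus.simps) (simp add: bern_coeff_def)

lemma magnus_S_1: "n \<ge> 2 \<Longrightarrow> magnus_S A n (Suc 0) t = commutator (magnus A (n - 1) t) (A t)"
  by (subst magnus_S.simps) simp

lemma magnus_S_rec: "n \<ge> 2 \<Longrightarrow> j \<ge> 2 \<Longrightarrow> magnus_S A n j t
    = (\<Sum>m = 1..n - j. commutator (magnus A m t) (magnus_S A (n - m) (j - 1) t))"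
  by (subst magnus_S.simps) simp

lemma integral_A: "t \<in> {0..T} \<Longrightarrow> integral {0..t} A = t *\<^sub>R B + integral {0..t} E"
proof -
  assume t: "t \<in> {0..T}"
  have "integral {0..t} A = integral {0..t} (\<lambda>s. B + E s)"
    by (rule integral_cong) (use t in \<open>auto intro: A_eq\<close>)
  also have "\<dots> = t *\<^sub>R B + integral {0..t} E"
    using t by (subst integral_add)
      (auto intro!: integrable_continuous_real continuous_on_subset[OF E_cont])
  finally show ?thesis .
qed

lemma integral_E_norm: "a \<in> {0..T} \<Longrightarrow> b \<in> {a..T} \<Longrightarrow> norm (integral {a..b} E) \<le> J * (b - a)"
  by (rule integral_bound) (auto intro!: continuous_on_subset[OF E_cont] E_norm)

lemma magnus_1_cont: "continuous_on {0..T} (magnus A (Suc 0))"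
  using indefinite_integral_continuous_1[OF integrable_continuous_real[OF A_cont]]
  by (simp add: magnus.simps)

text \<open>The recursion of \<open>majorant\<close> and \<open>majorant_S\<close> mirrors that of
  the Magnus terms, so its induction rule serves for these as well.\<close>

lemma magnus_cont:
  "continuous_on {0..T} (magnus A n)" "continuous_on {0..T} (magnus_S A n j)"
proof (induction n and n j rule: majorant_majorant_S.induct)
  case (1 n)
  consider "n = 0" | "n = 1" | "n \<ge> 2" by linarith
  then show ?case
  proof cases
    case 1
    then show ?thesis by (simp add: magnus.simps)
  next
    case 2
    then show ?thesis using magnus_1_cont by simp
  next
    case 3
    then show ?thesis
      unfolding ext[OF magnus_rec[OF 3]] using 1
      by (intro continuous_intros indefinite_integral_continuous_1 integrable_continuous_real) auto
  qed
next
  case (2 n j)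
  consider "n < 2 \<or> j = 0" | "n \<ge> 2" "j = Suc 0" | "n \<ge> 2" "j \<ge> 2" by linarith
  then show ?case
  proof cases
    case 1
    then show ?thesis by (auto simp: magnus_S.simps)
  next
    case n: 2
    \<comment> \<open>For \<open>n = 2\<close> the induction rule supplies nothing about \<Omega>_1,
      because \<open>majorant_S 2 1\<close> is a constant; order one is covered separately.\<close>
    have "continuous_on {0..T} (magnus A (n - 1))"
      using 2 n magnus_1_cont by (cases "n = 2") auto
    then show ?thesis
      unfolding n(2) ext[OF magnus_S_1[OF n(1)]] by (intro continuous_intros A_cont)
  next
    case 3
    then show ?thesis
      unfolding ext[OF magnus_S_rec[OF 3]] using 2
      by (intro continuous_intros) auto
  qed
qed

lemma magnus_1_norm: "t \<in> {0..T} \<Longrightarrow> norm (magnus A (Suc 0) t) \<le> (\<beta> + J) * t"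
  using integral_bound[of 0 t A "\<beta> + J"] A_norm continuous_on_subset[OF A_cont, of "{0..t}"]
  by (simp add: magnus_1)

text \<open>As [A t, A t] = 0, the first entry may be replaced by \<Omega>_1(t) - t A(t). There the
  multiples of \<open>B\<close> cancel, and what is left involves only \<open>E\<close> and has norm
  at most 2Jt.\<close>

lemma magnus_S_2_norm: 
  assumes t: "t \<in> {0..T}"
  shows "norm (magnus_S A 2 (Suc 0) t) \<le> 4 * J * (\<beta> + J) * t"
proof -
  have "magnus A (Suc 0) t - t *\<^sub>R A t = integral {0..t} E - t *\<^sub>R E t"
    unfolding magnus_1 integral_A[OF t] by (simp add: A_eq[OF t] scaleR_add_right)
  moreover have "norm (integral {0..t} E) \<le> J * t" using integral_E_norm[of 0 t] t by simp
  moreover have "norm (t *\<^sub>R E t) \<le> J * t" using mult_left_mono[OF E_norm[OF t], of t] t by (simp add: mult.commute)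
  ultimately have "norm (magnus A (Suc 0) t - t *\<^sub>R A t) \<le> 2 * (J * t)"
    using norm_triangle_ineq4[of "integral {0..t} E" "t *\<^sub>R E t"] by simp
  then have "norm (commutator (magnus A (Suc 0) t - t *\<^sub>R A t) (A t)) \<le> 2 * (2 * (J * t)) * (\<beta> + J)"
    by (intro norm_commutator_le A_norm t)
  also have "commutator (magnus A (Suc 0) t - t *\<^sub>R A t) (A t) = magnus_S A 2 (Suc 0) t"
    by (simp add: magnus_S_1 commutator_bilinear)
  finally show ?thesis by (simp add: mult_ac)
qed

lemma magnus_norm:
  shows "\<And>t. n \<ge> 2 \<Longrightarrow> t \<in> {0..T} \<Longrightarrow>
      norm (magnus A n t) \<le> majorant n * J * (\<beta> + J) ^ (n - 1) * t ^ n"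
    and "\<And>t. n \<ge> 2 \<Longrightarrow> j \<ge> 1 \<Longrightarrow> j < n \<Longrightarrow> t \<in> {0..T} \<Longrightarrow>
      norm (magnus_S A n j t) \<le> majorant_S n j * J * (\<beta> + J) ^ (n - 1) * t ^ (n - 1)"
proof (induction n and n j rule: majorant_majorant_S.induct)
  case (1 n)
  let ?c = "\<lambda>j. majorant_S n j * J * (\<beta> + J) ^ (n - 1)"
  have "norm (bern_coeff j *\<^sub>R integral {0..t} (magnus_S A n j)) \<le> \<bar>bern_coeff j\<bar> * (?c j * (t ^ n / n))"
    if j: "j \<in> {1..n - 1}" for j
  proof -
    have "((\<lambda>s. s ^ (n - 1)) has_integral (t ^ n / n - 0 ^ n / n)) {0..t}"
      using "1.prems" by (intro has_integral_real_antideriv) (auto intro!: derivative_eq_intros)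
    then have g: "((\<lambda>s. ?c j * s ^ (n - 1)) has_integral ?c j * (t ^ n / n)) {0..t}"
      using "1.prems" by (intro has_integral_mult_right) (simp add: zero_power)
    have f: "(magnus_S A n j has_integral integral {0..t} (magnus_S A n j)) {0..t}"
      using "1.prems" by (intro integrable_integral integrable_continuous_real
        continuous_on_subset[OF magnus_cont(2)]) auto
    have "norm (magnus_S A n j s) \<le> ?c j * s ^ (n - 1)" if "s \<in> {0..t}" for s
      using that j "1.prems" by (intro "1.IH") auto
    with f g have "norm (integral {0..t} (magnus_S A n j)) \<le> ?c j * (t ^ n / n)"
      by (rule has_integral_norm_le)
    then show ?thesis unfolding norm_scaleR by (rule mult_left_mono) simp
  qed
  then have "norm (magnus A n t) \<le> (\<Sum>j = 1..n - 1. \<bar>bern_coeff j\<bar> * (?c j * (t ^ n / n)))"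
    unfolding magnus_rec[OF "1.prems"(1)] by (rule sum_norm_le)
  also have "\<dots> = (\<Sum>j = 1..n - 1. \<bar>bern_coeff j\<bar> * majorant_S n j) * (J * (\<beta> + J) ^ (n - 1) * t ^ n / n)"
    unfolding sum_distrib_right by (rule sum.cong) simp_all
  also have "\<dots> = majorant n * J * (\<beta> + J) ^ (n - 1) * t ^ n"
    unfolding majorant_rec[OF "1.prems"(1), symmetric] using "1.prems" by simp
  finally show ?case .
next
  case (2 n j)
  have \<epsilon>: "0 \<le> \<beta> + J" "J \<le> \<beta> + J" using \<beta>_nonneg J_nonneg by auto
  have t: "0 \<le> t" using 2 by auto
  consider "j = 1" "n = 2" | "j = 1" "n \<ge> 3" | "j \<ge> 2" using "2.prems" by linarith
  then show ?case
  proof cases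
    case 1
    then show ?thesis
      unfolding 1 using magnus_S_2_norm[of t] "2.prems" by (simp add: mult_ac)
  next
    case n: 2
    have "norm (magnus A (n - 1) t) \<le> majorant (n - 1) * J * (\<beta> + J) ^ (n - 1 - 1) * t ^ (n - 1)"
      using n "2.prems" by (intro "2.IH") auto
    then have "norm (commutator (magnus A (n - 1) t) (A t))
        \<le> 2 * (majorant (n - 1) * J * (\<beta> + J) ^ (n - 1 - 1) * t ^ (n - 1)) * (\<beta> + J)"
      using "2.prems" by (intro norm_commutator_le A_norm)
    also have "\<dots> = 2 * majorant (n - 1) * J * ((\<beta> + J) * (\<beta> + J) ^ (n - 1 - 1)) * t ^ (n - 1)"
      by (simp add: mult_ac)
    also have "(\<beta> + J) * (\<beta> + J) ^ (n - 1 - 1) = (\<beta> + J) ^ (n - 1)"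
      using n power_Suc[of "\<beta> + J" "n - 1 - 1"] by (simp add: Suc_diff_Suc numeral_3_eq_3 del: power_Suc)
    finally show ?thesis using n by (simp add: magnus_S_1 majorant_S_1)
  next
    case 3
    have "norm (commutator (magnus A m t) (magnus_S A (n - m) (j - 1) t))
        \<le> 2 * majorant m * majorant_S (n - m) (j - 1) * (J * (\<beta> + J) ^ (n - 1) * t ^ (n - 1))"
      if m: "m \<in> {1..n - j}" for m
    proof -
      \<comment> \<open>The other factor of the bracket already carries \<open>J\<close>, so here
        \<open>J\<close> is enlarged to \<beta> + J, which also gives order one the same
        shape.\<close>
      have "norm (magnus A m t) \<le> majorant m * (\<beta> + J) ^ m * t ^ m"
      proof (cases "m = 1")
        case True
        then show ?thesis using magnus_1_norm "2.prems" by simp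
      next
        case False
        then have "norm (magnus A m t) \<le> majorant m * J * (\<beta> + J) ^ (m - 1) * t ^ m"
          using m 3 "2.prems" by (intro "2.IH") auto
        also have "\<dots> \<le> majorant m * (\<beta> + J) * (\<beta> + J) ^ (m - 1) * t ^ m"
          using \<epsilon> t by (intro mult_right_mono mult_left_mono) (auto simp: majorant_nonneg)
        also have "\<dots> = majorant m * (\<beta> + J) ^ m * t ^ m"
          using m by (cases m) auto
        finally show ?thesis .
      qed
      moreover have "norm (magnus_S A (n - m) (j - 1) t)
          \<le> majorant_S (n - m) (j - 1) * J * (\<beta> + J) ^ (n - m - 1) * t ^ (n - m - 1)"
        using m 3 "2.prems" by (intro "2.IH") auto
      ultimately have "norm (commutator (magnus A m t) (magnus_S A (n - m) (j - 1) t))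
        \<le> 2 * (majorant m * (\<beta> + J) ^ m * t ^ m)
          * (majorant_S (n - m) (j - 1) * J * (\<beta> + J) ^ (n - m - 1) * t ^ (n - m - 1))"
        by (rule norm_commutator_le)
      also have "\<dots> = 2 * majorant m * majorant_S (n - m) (j - 1)
          * (J * ((\<beta> + J) ^ m * (\<beta> + J) ^ (n - m - 1)) * (t ^ m * t ^ (n - m - 1)))"
        by (simp add: mult_ac)
      also have "\<dots> = 2 * majorant m * majorant_S (n - m) (j - 1)
          * (J * (\<beta> + J) ^ (n - 1) * t ^ (n - 1))"
      proof -
        have "x ^ m * x ^ (n - m - 1) = x ^ (n - 1)" for x :: real
          unfolding power_add[symmetric] using m 3 by (intro arg_cong[of _ _ "power x"]) auto
        then show ?thesis by (simp only:)
      qed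
      finally show ?thesis .
    qed
    then have "norm (magnus_S A n j t) \<le> (\<Sum>m = 1..n - j.
        2 * majorant m * majorant_S (n - m) (j - 1) * (J * (\<beta> + J) ^ (n - 1) * t ^ (n - 1)))"
      unfolding magnus_S_rec[OF "2.prems"(1) 3] by (rule sum_norm_le)
    then show ?thesis
      unfolding majorant_S_rec[OF 3] sum_distrib_right by (simp add: mult.assoc)
  qed
qed

text \<open>For orders two and three the recursion yields only the constants \<open>1\<close> and \<open>5/9\<close>. In the terms
  containing \<open>B\<close> the time averages of \<open>E\<close> partly cancel, which integration by parts makes visible.\<close>

lemma antideriv_E: "t \<in> {0..T} \<Longrightarrow>
    ((\<lambda>u. integral {0..u} E) has_vector_derivative E t) (at t within {0..T})"
  by (rule integral_has_vector_derivative[OF E_cont])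

lemma antideriv_A: "t \<in> {0..T} \<Longrightarrow>
    (magnus A (Suc 0) has_vector_derivative A t) (at t within {0..T})"
  unfolding magnus_1[abs_def] by (rule integral_has_vector_derivative[OF A_cont])

lemma magnus_1_eq: "t \<in> {0..T} \<Longrightarrow> magnus A (Suc 0) t = t *\<^sub>R B + integral {0..t} E"
  by (simp add: magnus_1 integral_A)

lemma magnus_2_eq: "magnus A 2 t = (- 1/2) *\<^sub>R integral {0..t} (magnus_S A 2 (Suc 0))"
  by (simp add: magnus_rec)

lemma magnus_0: "magnus A n 0 = 0"
proof -
  consider "n = 0" | "n = Suc 0" | "n \<ge> 2" by linarith
  then show ?thesis by cases (auto simp: magnus_rec magnus_1 magnus.simps[of A 0])
qed

lemma integral_modulo_exact:
  assumes "continuous_on {0..T} g" "continuous_on {0..T} r"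
    and "\<And>t. t \<in> {0..T} \<Longrightarrow> (p has_vector_derivative g t - r t) (at t within {0..T})"
    and "p T = p 0"
  shows "integral {0..T} g = integral {0..T} (r :: real \<Rightarrow> 'a)"
proof -
  have "((\<lambda>t. g t - r t) has_integral p T - p 0) {0..T}"
    by (rule fundamental_theorem_of_calculus) (use assms T_nonneg in auto)
  then have "integral {0..T} (\<lambda>t. g t - r t) = 0" using assms(4) by auto
  then show ?thesis
    using assms by (simp add: integral_diff integrable_continuous_real)
qed

text \<open>Up to the derivative of [B, (T - t) e], which vanishes at both ends before
  differentiation, the term -[B, e] becomes -[B, (T - t) E]. The weight of [B, E] is then 2t - T
  instead of \<open>t\<close>, and the integral of its absolute value is T^2/2.\<close>

lemma magnus_2_norm: "norm (magnus A 2 T) \<le> 1/2 * (J * T) * ((\<beta> + J) * T)"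
proof -
  define e where "e t = integral {0..t} E" for t
  define r where "r t = commutator B ((2 * t - T) *\<^sub>R E t) + commutator (e t) (E t)" for t
  have e': "(e has_vector_derivative E t) (at t within {0..T})" if "t \<in> {0..T}" for t
    using antideriv_E[OF that] by (simp add: e_def[abs_def])
  have e_norm: "norm (e t) \<le> J * t" if "t \<in> {0..T}" for t
    using integral_E_norm[of 0 t] that by (simp add: e_def)
  have e_cont: "continuous_on {0..T} e"
    unfolding e_def by (intro indefinite_integral_continuous_1 integrable_continuous_real E_cont)
  have r_cont: "continuous_on {0..T} r"
    unfolding r_def by (intro continuous_intros e_cont E_cont)
  have "integral {0..T} (magnus_S A 2 (Suc 0)) = integral {0..T} r"
  proof (rule integral_modulo_exact[where p = "\<lambda>t. commutator B ((T - t) *\<^sub>R e t)"])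
    fix t assume t: "t \<in> {0..T}"
    have "magnus_S A 2 (Suc 0) t = commutator (t *\<^sub>R B + e t) (B + E t)"
      using t by (simp add: magnus_S_1 magnus_1_eq e_def A_eq)
    also have "\<dots> = commutator B (t *\<^sub>R E t) - commutator B (e t) + commutator (e t) (E t)"
      using commutator_swap[of "e t" B] by (simp add: commutator_bilinear)
    finally have eq: "magnus_S A 2 (Suc 0) t
      = commutator B (t *\<^sub>R E t) - commutator B (e t) + commutator (e t) (E t)" .
    have "magnus_S A 2 (Suc 0) t - r t
        = commutator 0 ((T - t) *\<^sub>R e t) + commutator B ((T - t) *\<^sub>R E t + (- 1) *\<^sub>R e t)"
    proof -
      have "(2 * t - T) *\<^sub>R X = t *\<^sub>R X - (T - t) *\<^sub>R X" for X :: 'a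
        unfolding scaleR_diff_left[symmetric] by simp
      then show ?thesis
        using eq by (simp only: r_def) (simp add: commutator_bilinear algebra_simps)
    qed
    moreover have "((\<lambda>t. commutator B ((T - t) *\<^sub>R e t)) has_vector_derivative
        commutator 0 ((T - t) *\<^sub>R e t) + commutator B ((T - t) *\<^sub>R E t + (- 1) *\<^sub>R e t)) (at t within {0..T})"
      by (intro has_vector_derivative_commutator has_vector_derivative_const has_vector_derivative_scaleR e' t)
        (auto intro!: derivative_eq_intros)
    ultimately show "((\<lambda>t. commutator B ((T - t) *\<^sub>R e t)) has_vector_derivative
        magnus_S A 2 (Suc 0) t - r t) (at t within {0..T})" by simp
  qed (use r_cont magnus_cont(2) in \<open>auto simp: e_def\<close>)
  moreover have "norm (integral {0..T} r) \<le> 2 * \<beta> * J * (T\<^sup>2 / 2) + 2 * J\<^sup>2 * (T\<^sup>2 / 2)"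
  proof (rule has_integral_norm_le)
    show "(r has_integral integral {0..T} r) {0..T}"
      by (intro integrable_integral integrable_continuous_real r_cont)
    have "((\<lambda>t. t) has_integral T\<^sup>2 / 2 - 0\<^sup>2 / 2) {0..T}"
      using T_nonneg by (intro has_integral_real_antideriv) (auto intro!: derivative_eq_intros)
    then show "((\<lambda>t. 2 * \<beta> * J * \<bar>2 * t - T\<bar> + 2 * J\<^sup>2 * t) has_integral
        2 * \<beta> * J * (T\<^sup>2 / 2) + 2 * J\<^sup>2 * (T\<^sup>2 / 2)) {0..T}"
      using T_nonneg by (intro has_integral_add has_integral_mult_right has_integral_abs_moments(1)) auto
  next
    fix t assume t: "t \<in> {0..T}"
    have "norm (commutator B ((2 * t - T) *\<^sub>R E t)) \<le> 2 * \<beta> * (\<bar>2 * t - T\<bar> * J)"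
      by (rule norm_commutator_le) (auto simp: B_norm intro!: mult_left_mono E_norm t)
    moreover have "norm (commutator (e t) (E t)) \<le> 2 * (J * t) * J"
      by (intro norm_commutator_le e_norm E_norm t)
    ultimately show "norm (r t) \<le> 2 * \<beta> * J * \<bar>2 * t - T\<bar> + 2 * J\<^sup>2 * t"
      unfolding r_def by (intro order_trans[OF norm_triangle_ineq]) (simp add: power2_eq_square algebra_simps)
  qed
  ultimately have "norm (magnus A 2 T) \<le> 1/2 * (2 * \<beta> * J * (T\<^sup>2 / 2) + 2 * J\<^sup>2 * (T\<^sup>2 / 2))"
    by (simp add: magnus_2_eq)
  then show ?thesis by (simp add: power2_eq_square algebra_simps)
qed

text \<open>Modulo the derivative of \<open>p\<close> the integrand is r/6, where \<open>r\<close>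
  has parts linear, quadratic and cubic in \<open>E\<close>. Against 6 * 2/9 (\<beta> + J)^2 J the
  cubic part has exactly the allowed coefficient 4/3, while the others have 9/10 <= 4/3 and 64/27 <=
  8/3.\<close>

lemma magnus_3_norm: "norm (magnus A 3 T) \<le> 2/9 * (J * T) * ((\<beta> + J) * T)\<^sup>2"
proof (cases "T = 0")
  case True
  then show ?thesis by (simp add: magnus_0)
next
  case False
  then have T_pos: "T > 0" using T_nonneg by simp
  define e where "e t = integral {0..t} E" for t
  define l where "l t = e T - e t" for t
  define K where "K = magnus A (Suc 0)"
  define L where "L t = K T - K t" for t
  define w where "w t = 2 * (t * (T - t)) - (T - t)\<^sup>2 / 2 - t\<^sup>2 / 2" for t
  define r where "r t = w t *\<^sub>R commutator (commutator B (E t)) B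
      + commutator (commutator B (E t)) ((3 * t - T) *\<^sub>R l t + (2 * T - 3 * t) *\<^sub>R e t)
      + (commutator (commutator (e t) (E t)) (l t) + commutator (commutator (l t) (E t)) (e t))" for t
  define g where "g t = (- 1/2) *\<^sub>R magnus_S A 3 (Suc 0) t + (1/12) *\<^sub>R magnus_S A 3 2 t" for t
  \<comment> \<open>The first summand integrates [\<Omega>_2, A] by parts, the second is the exact
    part of \<open>third_order_identity2\<close>, and the rest is that of
    \<open>third_order_identity\<close>. Every summand vanishes at 0 and at
    \<open>T\<close>.\<close>
  define p where "p t = (1/2) *\<^sub>R commutator (magnus A 2 t) (L t)
      - (1/12) *\<^sub>R commutator (commutator (K T) (K t)) (K t)
      + (1/6) *\<^sub>R ((T - t) *\<^sub>R commutator (commutator B (e t)) (l t)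
        - t *\<^sub>R commutator (commutator B (l t)) (e t)
        + (((T - t)\<^sup>2 / 2) *\<^sub>R commutator (commutator B (e t)) B
          - (t\<^sup>2 / 2) *\<^sub>R commutator (commutator B (l t)) B))" for t
  have e': "(e has_vector_derivative E t) (at t within {0..T})" if "t \<in> {0..T}" for t
    using antideriv_E[OF that] by (simp add: e_def[abs_def])
  have l': "(l has_vector_derivative - E t) (at t within {0..T})" if "t \<in> {0..T}" for t
    unfolding l_def using e'[OF that] by (auto intro!: derivative_eq_intros)
  have K': "(K has_vector_derivative A t) (at t within {0..T})" if "t \<in> {0..T}" for t
    using antideriv_A[OF that] by (simp add: K_def)
  have L': "(L has_vector_derivative - A t) (at t within {0..T})" if "t \<in> {0..T}" for t
    unfolding L_def using K'[OF that] by (auto intro!: derivative_eq_intros)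
  have \<Omega>': "(magnus A 2 has_vector_derivative (- 1/2) *\<^sub>R commutator (K t) (A t)) (at t within {0..T})"
    if "t \<in> {0..T}" for t
  proof -
    have "((\<lambda>t. (- 1/2) *\<^sub>R integral {0..t} (magnus_S A 2 (Suc 0))) has_vector_derivative
        (- 1/2) *\<^sub>R magnus_S A 2 (Suc 0) t) (at t within {0..T})"
      by (rule bounded_linear.has_vector_derivative[OF bounded_linear_scaleR_right
          integral_has_vector_derivative[OF magnus_cont(2) that]])
    then show ?thesis by (simp add: magnus_2_eq[abs_def] magnus_S_1 K_def)
  qed
  have e_norm: "norm (e t) \<le> J * t" if "t \<in> {0..T}" for t
    using integral_E_norm[of 0 t] that by (simp add: e_def)
  have l_norm: "norm (l t) \<le> J * (T - t)" if "t \<in> {0..T}" for t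
  proof -
    have "l t = integral {t..T} E"
      using Henstock_Kurzweil_Integration.integral_combine[of 0 t T E] that
      by (simp add: l_def e_def integrable_continuous_real E_cont algebra_simps)
    then show ?thesis using integral_E_norm[of t T] that by simp
  qed
  have e_cont: "continuous_on {0..T} e"
    unfolding e_def by (intro indefinite_integral_continuous_1 integrable_continuous_real E_cont)
  have l_cont: "continuous_on {0..T} l"
    unfolding l_def by (intro continuous_intros e_cont)
  have r_cont: "continuous_on {0..T} r"
    unfolding r_def w_def by (intro continuous_intros e_cont l_cont E_cont) auto
  have g_cont: "continuous_on {0..T} g"
    unfolding g_def by (intro continuous_intros magnus_cont)
  have "magnus A 3 T = integral {0..T} g"
  proof -
    have "{1..3 - 1 :: nat} = {1, 2}" by auto
    then have "magnus A 3 T = (- 1/2) *\<^sub>R integral {0..T} (magnus_S A 3 (Suc 0))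
        + (1/12) *\<^sub>R integral {0..T} (magnus_S A 3 2)"
      by (subst magnus_rec) (simp_all only:, simp_all)
    also have "\<dots> = integral {0..T} g"
      unfolding g_def by (subst integral_add)
        (auto intro!: integrable_continuous_real continuous_intros magnus_cont)
    finally show ?thesis .
  qed
  also have "\<dots> = integral {0..T} (\<lambda>t. (1/6) *\<^sub>R r t)"
  proof (rule integral_modulo_exact[where p = p])
    fix t assume t: "t \<in> {0..T}"
    let ?q = "- commutator (commutator B (e t)) (l t) + (T - t) *\<^sub>R commutator (commutator B (E t)) (l t)
         - (T - t) *\<^sub>R commutator (commutator B (e t)) (E t)
         - (commutator (commutator B (l t)) (e t) - t *\<^sub>R commutator (commutator B (E t)) (e t)
            + t *\<^sub>R commutator (commutator B (l t)) (E t))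
         + (- (T - t) *\<^sub>R commutator (commutator B (e t)) B
            + ((T - t) * (T - t) / 2) *\<^sub>R commutator (commutator B (E t)) B)
         - (t *\<^sub>R commutator (commutator B (l t)) B
            - (t * t / 2) *\<^sub>R commutator (commutator B (E t)) B)"
    have K: "K t = t *\<^sub>R B + e t" using magnus_1_eq[OF t] by (simp add: K_def e_def)
    have L: "L t = (T - t) *\<^sub>R B + l t"
      using magnus_1_eq[of T] T_nonneg
      by (simp add: L_def K l_def) (simp add: K_def e_def scaleR_diff_left)
    have "commutator (commutator (K t) (A t)) (L t) + commutator (commutator (L t) (A t)) (K t) = r t + ?q"
    proof -
      have "w t = t * (T - t) + t * (T - t) - (T - t) * (T - t) / 2 - t * t / 2"
        "3 * t - T = t + t - (T - t)" "2 * T - 3 * t = (T - t) + (T - t) - t"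
        by (auto simp: w_def power2_eq_square)
      then show ?thesis
        unfolding K L A_eq[OF t] third_order_identity[of t B "e t" "E t" "T - t" "l t"] r_def
        by (simp only: add.assoc)
    qed
    note q = this
    have B_comm: "((\<lambda>t. commutator B (f t)) has_vector_derivative commutator B f') (at t within {0..T})"
      if "(f has_vector_derivative f') (at t within {0..T})" for f f'
      using has_vector_derivative_commutator[OF has_vector_derivative_const that, of B]
      by (simp add: commutator_bilinear)
    have comm_B: "((\<lambda>t. commutator (f t) B) has_vector_derivative commutator f' B) (at t within {0..T})"
      if "(f has_vector_derivative f') (at t within {0..T})" for f f'
      using has_vector_derivative_commutator[OF that has_vector_derivative_const, of B]
      by (simp add: commutator_bilinear)
    note scale = bounded_linear.has_vector_derivative[OF bounded_linear_scaleR_right]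
    have d1: "((\<lambda>t. (1/2) *\<^sub>R commutator (magnus A 2 t) (L t)) has_vector_derivative
        (1/2) *\<^sub>R (commutator ((- 1/2) *\<^sub>R commutator (K t) (A t)) (L t)
          + commutator (magnus A 2 t) (- A t))) (at t within {0..T})"
      by (intro scale has_vector_derivative_commutator \<Omega>' L' t)
    have "((\<lambda>t. (1/12) *\<^sub>R commutator (commutator (K T) (K t)) (K t)) has_vector_derivative
        (1/12) *\<^sub>R (commutator (commutator 0 (K t) + commutator (K T) (A t)) (K t)
          + commutator (commutator (K T) (K t)) (A t))) (at t within {0..T})"
      by (intro scale has_vector_derivative_commutator has_vector_derivative_const K' t)
    then have d2: "((\<lambda>t. (1/12) *\<^sub>R commutator (commutator (K T) (K t)) (K t)) has_vector_derivative
        (1/12) *\<^sub>R (commutator (commutator (K T) (A t)) (K t)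
          + commutator (commutator (K T) (K t)) (A t))) (at t within {0..T})"
      by (simp only: commutator_bilinear add_0)
    have "((\<lambda>t. (T - t) *\<^sub>R commutator (commutator B (e t)) (l t)) has_vector_derivative
        (T - t) *\<^sub>R (commutator (commutator B (E t)) (l t) + commutator (commutator B (e t)) (- E t))
        + (- 1) *\<^sub>R commutator (commutator B (e t)) (l t)) (at t within {0..T})"
      by (intro has_vector_derivative_scaleR has_vector_derivative_commutator B_comm e' l' t)
        (auto intro!: derivative_eq_intros)
    moreover have "((\<lambda>t. t *\<^sub>R commutator (commutator B (l t)) (e t)) has_vector_derivative
        t *\<^sub>R (commutator (commutator B (- E t)) (e t) + commutator (commutator B (l t)) (E t))
        + 1 *\<^sub>R commutator (commutator B (l t)) (e t)) (at t within {0..T})"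
      by (intro has_vector_derivative_scaleR has_vector_derivative_commutator B_comm e' l' t)
        (auto intro!: derivative_eq_intros)
    moreover have "((\<lambda>t. ((T - t)\<^sup>2 / 2) *\<^sub>R commutator (commutator B (e t)) B) has_vector_derivative
        ((T - t)\<^sup>2 / 2) *\<^sub>R commutator (commutator B (E t)) B
        + (- (T - t)) *\<^sub>R commutator (commutator B (e t)) B) (at t within {0..T})"
      by (intro has_vector_derivative_scaleR B_comm comm_B e' t) (auto intro!: derivative_eq_intros)
    moreover have "((\<lambda>t. (t\<^sup>2 / 2) *\<^sub>R commutator (commutator B (l t)) B) has_vector_derivative
        (t\<^sup>2 / 2) *\<^sub>R commutator (commutator B (- E t)) B
        + t *\<^sub>R commutator (commutator B (l t)) B) (at t within {0..T})"
      by (intro has_vector_derivative_scaleR B_comm comm_B l' t) (auto intro!: derivative_eq_intros)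
    ultimately have "((\<lambda>t. (1/6) *\<^sub>R ((T - t) *\<^sub>R commutator (commutator B (e t)) (l t)
        - t *\<^sub>R commutator (commutator B (l t)) (e t)
        + (((T - t)\<^sup>2 / 2) *\<^sub>R commutator (commutator B (e t)) B
          - (t\<^sup>2 / 2) *\<^sub>R commutator (commutator B (l t)) B))) has_vector_derivative
        (1/6) *\<^sub>R (((T - t) *\<^sub>R (commutator (commutator B (E t)) (l t) + commutator (commutator B (e t)) (- E t))
        + (- 1) *\<^sub>R commutator (commutator B (e t)) (l t))
        - (t *\<^sub>R (commutator (commutator B (- E t)) (e t) + commutator (commutator B (l t)) (E t))
        + 1 *\<^sub>R commutator (commutator B (l t)) (e t))
        + ((((T - t)\<^sup>2 / 2) *\<^sub>R commutator (commutator B (E t)) B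
        + (- (T - t)) *\<^sub>R commutator (commutator B (e t)) B)
        - ((t\<^sup>2 / 2) *\<^sub>R commutator (commutator B (- E t)) B
        + t *\<^sub>R commutator (commutator B (l t)) B)))) (at t within {0..T})"
      (is "(_ has_vector_derivative (1/6) *\<^sub>R ?q') _")
      by (intro scale has_vector_derivative_add has_vector_derivative_diff)
    moreover have "?q' = ?q"
    proof -
      have "u *\<^sub>R (x + - y) + (- 1) *\<^sub>R z - (t *\<^sub>R (- x' + y') + 1 *\<^sub>R z')
          + ((v *\<^sub>R a + (- u) *\<^sub>R b) - (t' *\<^sub>R (- a) + t *\<^sub>R c))
        = - z + u *\<^sub>R x - u *\<^sub>R y - (z' - t *\<^sub>R x' + t *\<^sub>R y')
          + (- u *\<^sub>R b + v *\<^sub>R a) - (t *\<^sub>R c - t' *\<^sub>R a)"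
        for u v t' and x y z x' y' z' a b c :: 'a
        by (simp add: algebra_simps)
      then show ?thesis
        by (simp only: commutator_bilinear power2_eq_square)
    qed
    ultimately have d3: "((\<lambda>t. (1/6) *\<^sub>R ((T - t) *\<^sub>R commutator (commutator B (e t)) (l t)
        - t *\<^sub>R commutator (commutator B (l t)) (e t)
        + (((T - t)\<^sup>2 / 2) *\<^sub>R commutator (commutator B (e t)) B
          - (t\<^sup>2 / 2) *\<^sub>R commutator (commutator B (l t)) B))) has_vector_derivative
        (1/6) *\<^sub>R ?q) (at t within {0..T})" by (simp only:)
    have "(p has_vector_derivative (1/2) *\<^sub>R (commutator ((- 1/2) *\<^sub>R commutator (K t) (A t)) (L t)
          + commutator (magnus A 2 t) (- A t))
        - (1/12) *\<^sub>R (commutator (commutator (K T) (A t)) (K t) + commutator (commutator (K T) (K t)) (A t))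
        + (1/6) *\<^sub>R ?q) (at t within {0..T})"
      unfolding p_def by (intro has_vector_derivative_add has_vector_derivative_diff d1 d2 d3)
    moreover have "g t - (1/6) *\<^sub>R r t = (1/2) *\<^sub>R (commutator ((- 1/2) *\<^sub>R commutator (K t) (A t)) (L t)
          + commutator (magnus A 2 t) (- A t))
        - (1/12) *\<^sub>R (commutator (commutator (K T) (A t)) (K t) + commutator (commutator (K T) (K t)) (A t))
        + (1/6) *\<^sub>R ?q"
    proof -
      have "L t + K t = K T" by (simp add: L_def)
      with third_order_identity2[of "K t" "A t" "L t"] have
        "(1/4) *\<^sub>R commutator (commutator (K t) (A t)) (L t)
          + (1/12) *\<^sub>R commutator (K t) (commutator (K t) (A t))
        = (1/6) *\<^sub>R r t + (1/6) *\<^sub>R ?q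
          - (1/12) *\<^sub>R (commutator (commutator (K T) (A t)) (K t) + commutator (commutator (K T) (K t)) (A t))"
        unfolding q by (simp only: scaleR_add_right[of "1/6" "r t"])
      moreover have "g t = (- 1/2) *\<^sub>R commutator (magnus A 2 t) (A t)
          + (1/12) *\<^sub>R commutator (K t) (commutator (K t) (A t))"
        by (simp add: g_def magnus_S_1 magnus_S_rec K_def)
      moreover have "(- 1/2) *\<^sub>R m + c - (1/6) *\<^sub>R r t
          = (1/2) *\<^sub>R ((- 1/2) *\<^sub>R x + - m) - y + z"
        if "(1/4) *\<^sub>R x + c = (1/6) *\<^sub>R r t + z - y" for m c x y z
        using that by (simp add: algebra_simps)
      ultimately show ?thesis
        by (simp only: commutator_bilinear)
    qed
    ultimately show "(p has_vector_derivative g t - (1/6) *\<^sub>R r t) (at t within {0..T})" by simp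
  next
    have [simp]: "l T = 0" "L T = 0" "e 0 = 0" "K 0 = 0"
      by (simp_all add: l_def L_def e_def K_def magnus_0)
    show "p T = p 0" by (simp add: p_def commutator_bilinear magnus_0)
  qed (intro continuous_intros g_cont r_cont)+
  also have "\<dots> = (1/6) *\<^sub>R integral {0..T} r" by simp
  finally have "norm (magnus A 3 T) = 1/6 * norm (integral {0..T} r)" by simp
  moreover have "norm (integral {0..T} r)
      \<le> 4 * \<beta>\<^sup>2 * J * (9/40 * T ^ 3) + 4 * \<beta> * J\<^sup>2 * (8/27 * T ^ 3 + 8/27 * T ^ 3) + 8 * J ^ 3 * (T ^ 3 / 6)"
  proof (rule has_integral_norm_le)
    show "(r has_integral integral {0..T} r) {0..T}"
      by (intro integrable_integral integrable_continuous_real r_cont)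
    \<comment> \<open>Antiderivative of w^2 with F(T) = T^5/20, so that 2 F(T)/T^2 + T^3/8 = 9/40
      T^3.\<close>
    define F where "F t = 9/5 * t ^ 5 - 9/2 * T * t ^ 4 + 4 * T\<^sup>2 * t ^ 3 - 3/2 * T ^ 3 * t\<^sup>2 + T ^ 4 / 4 * t" for t
    have "((\<lambda>t. (w t)\<^sup>2) has_integral F T - F 0) {0..T}"
    proof (rule has_integral_real_antideriv[OF T_nonneg])
      fix t
      have "(F has_real_derivative
          9 * t ^ 4 - 18 * T * t ^ 3 + 12 * T\<^sup>2 * t\<^sup>2 - 3 * T ^ 3 * t + T ^ 4 / 4) (at t)"
        unfolding F_def by (auto intro!: derivative_eq_intros)
      also have "9 * t ^ 4 - 18 * T * t ^ 3 + 12 * T\<^sup>2 * t\<^sup>2 - 3 * T ^ 3 * t + T ^ 4 / 4 = (w t)\<^sup>2"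
        unfolding w_def by (simp add: field_simps power2_eq_square power3_eq_cube power4_eq_xxxx)
      finally show "(F has_real_derivative (w t)\<^sup>2) (at t)" .
    qed
    then have "((\<lambda>t. 2 / T\<^sup>2 * (w t)\<^sup>2 + T\<^sup>2 / 8) has_integral 2 / T\<^sup>2 * (F T - F 0) + T * (T\<^sup>2 / 8)) {0..T}"
      using has_integral_const_real[of "T\<^sup>2 / 8" 0 T] T_nonneg
      by (intro has_integral_add has_integral_mult_right) auto
    also have "2 / T\<^sup>2 * (F T - F 0) + T * (T\<^sup>2 / 8) = 9/40 * T ^ 3"
      using T_pos by (simp add: F_def field_simps eval_nat_numeral)
    finally have w_int: "((\<lambda>t. 2 * (w t)\<^sup>2 / T\<^sup>2 + T\<^sup>2 / 8) has_integral 9/40 * T ^ 3) {0..T}" by simp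
    have "((\<lambda>t. t * (T - t)) has_integral (T * T\<^sup>2 / 2 - T ^ 3 / 3 - (T * 0\<^sup>2 / 2 - 0 ^ 3 / 3))) {0..T}"
      by (rule has_integral_real_antideriv[OF T_nonneg])
        (auto intro!: derivative_eq_intros simp: algebra_simps power2_eq_square)
    then have "((\<lambda>t. t * (T - t)) has_integral T ^ 3 / 6) {0..T}"
      by (simp add: power2_eq_square power3_eq_cube field_simps)
    then show "((\<lambda>t. 4 * \<beta>\<^sup>2 * J * (2 * (w t)\<^sup>2 / T\<^sup>2 + T\<^sup>2 / 8)
          + 4 * \<beta> * J\<^sup>2 * (\<bar>3 * t - T\<bar> * (T - t) + \<bar>2 * T - 3 * t\<bar> * t)
          + 8 * J ^ 3 * (t * (T - t))) has_integral
        4 * \<beta>\<^sup>2 * J * (9/40 * T ^ 3) + 4 * \<beta> * J\<^sup>2 * (8/27 * T ^ 3 + 8/27 * T ^ 3) + 8 * J ^ 3 * (T ^ 3 / 6)) {0..T}"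
      by (intro has_integral_add has_integral_mult_right has_integral_abs_moments T_nonneg w_int)
  next
    fix t assume t: "t \<in> {0..T}"
    have F: "norm (commutator B (E t)) \<le> 2 * \<beta> * J"
      by (intro norm_commutator_le B_norm E_norm t)
    \<comment> \<open>Here w = 3t(T - t) - T^2/2 has zeros at irrational multiples of
      \<open>T\<close>. Instead of integrating |w|, it is majorized by a quadratic in
      \<open>w\<close> that touches |w| at T^2/4, the value of \<open>w\<close> at T/2.\<close>
    have "\<bar>w t\<bar> \<le> 2 * (w t)\<^sup>2 / T\<^sup>2 + T\<^sup>2 / 8"
    proof -
      have "0 \<le> (4 * \<bar>w t\<bar> - T\<^sup>2)\<^sup>2" by simp
      then have "\<bar>w t\<bar> * T\<^sup>2 \<le> 2 * (w t)\<^sup>2 + T\<^sup>2 * T\<^sup>2 / 8"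
        unfolding power2_diff by (simp add: power_mult_distrib)
      then show ?thesis using T_pos by (simp add: field_simps)
    qed
    moreover have "norm (w t *\<^sub>R commutator (commutator B (E t)) B) \<le> \<bar>w t\<bar> * (2 * (2 * \<beta> * J) * \<beta>)"
      unfolding norm_scaleR by (intro mult_left_mono norm_commutator_le F B_norm) simp
    moreover have "0 \<le> 2 * (2 * \<beta> * J) * \<beta>" using \<beta>_nonneg J_nonneg by simp
    ultimately have n1: "norm (w t *\<^sub>R commutator (commutator B (E t)) B)
        \<le> (2 * (w t)\<^sup>2 / T\<^sup>2 + T\<^sup>2 / 8) * (2 * (2 * \<beta> * J) * \<beta>)"
      by (meson mult_right_mono order_trans)
    have "norm ((3 * t - T) *\<^sub>R l t + (2 * T - 3 * t) *\<^sub>R e t)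
        \<le> \<bar>3 * t - T\<bar> * (J * (T - t)) + \<bar>2 * T - 3 * t\<bar> * (J * t)"
      by (rule norm_triangle_le)
        (use e_norm[OF t] l_norm[OF t] in \<open>auto intro!: add_mono mult_left_mono\<close>)
    then have n2: "norm (commutator (commutator B (E t)) ((3 * t - T) *\<^sub>R l t + (2 * T - 3 * t) *\<^sub>R e t))
        \<le> 2 * (2 * \<beta> * J) * (\<bar>3 * t - T\<bar> * (J * (T - t)) + \<bar>2 * T - 3 * t\<bar> * (J * t))"
      by (intro norm_commutator_le F)
    have n3: "norm (commutator (commutator (e t) (E t)) (l t)) \<le> 2 * (2 * (J * t) * J) * (J * (T - t))"
      "norm (commutator (commutator (l t) (E t)) (e t)) \<le> 2 * (2 * (J * (T - t)) * J) * (J * t)"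
      by (intro norm_commutator_le e_norm l_norm E_norm t)+
    have "norm (r t) \<le> (2 * (w t)\<^sup>2 / T\<^sup>2 + T\<^sup>2 / 8) * (2 * (2 * \<beta> * J) * \<beta>)
        + 2 * (2 * \<beta> * J) * (\<bar>3 * t - T\<bar> * (J * (T - t)) + \<bar>2 * T - 3 * t\<bar> * (J * t))
        + (2 * (2 * (J * t) * J) * (J * (T - t)) + 2 * (2 * (J * (T - t)) * J) * (J * t))"
      unfolding r_def by (intro norm_triangle_mono n1 n2 n3)
    also have "\<dots> = 4 * \<beta>\<^sup>2 * J * (2 * (w t)\<^sup>2 / T\<^sup>2 + T\<^sup>2 / 8)
          + 4 * \<beta> * J\<^sup>2 * (\<bar>3 * t - T\<bar> * (T - t) + \<bar>2 * T - 3 * t\<bar> * t)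
          + 8 * J ^ 3 * (t * (T - t))"
    proof -
      have "v * (2 * (2 * \<beta> * J) * \<beta>) + 2 * (2 * \<beta> * J) * (a * (J * u) + b * (J * t))
          + (2 * (2 * (J * t) * J) * (J * u) + 2 * (2 * (J * u) * J) * (J * t))
        = 4 * \<beta>\<^sup>2 * J * v + 4 * \<beta> * J\<^sup>2 * (a * u + b * t) + 8 * J ^ 3 * (t * u)" for v a b u
        by (simp add: power2_eq_square power3_eq_cube algebra_simps)
      then show ?thesis .
    qed
    finally show "norm (r t) \<le> \<dots>" .
  qed
  moreover have "4 * \<beta>\<^sup>2 * J * (9/40 * T ^ 3) + 4 * \<beta> * J\<^sup>2 * (8/27 * T ^ 3 + 8/27 * T ^ 3) + 8 * J ^ 3 * (T ^ 3 / 6)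
      \<le> 6 * (2/9 * (J * T) * ((\<beta> + J) * T)\<^sup>2)"
  proof -
    have "6 * (2/9 * (J * T) * ((\<beta> + J) * T)\<^sup>2)
        - (4 * \<beta>\<^sup>2 * J * (9/40 * T ^ 3) + 4 * \<beta> * J\<^sup>2 * (8/27 * T ^ 3 + 8/27 * T ^ 3) + 8 * J ^ 3 * (T ^ 3 / 6))
      = J * T ^ 3 * (13/30 * \<beta>\<^sup>2 + 8/27 * (\<beta> * J))"
      by (simp add: power2_eq_square power3_eq_cube field_simps)
    moreover have "0 \<le> J * T ^ 3 * (13/30 * \<beta>\<^sup>2 + 8/27 * (\<beta> * J))"
      using J_nonneg \<beta>_nonneg T_nonneg by simp
    ultimately show ?thesis by linarith
  qed
  ultimately show ?thesis by linarith
qed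

section \<open>Orders four and above, directly from the majorants\<close>

lemma magnus_4_norm: "norm (magnus A 4 T) \<le> 11/9 * (J * T) * ((\<beta> + J) * T) ^ 3"
proof -
  have "norm (magnus A 4 T) \<le> 7/18 * J * (\<beta> + J) ^ 3 * T ^ 4"
    using magnus_norm(1)[of 4 T] T_nonneg by (simp add: majorant_4)
  also have "\<dots> \<le> 11/9 * J * (\<beta> + J) ^ 3 * T ^ 4"
    using T_nonneg J_nonneg \<beta>_nonneg by (intro mult_right_mono) auto
  also have "\<dots> = 11/9 * (J * T) * ((\<beta> + J) * T) ^ 3"
    by (simp add: power_mult_distrib eval_nat_numeral mult_ac)
  finally show ?thesis .
qed

lemma magnus_tail:
  assumes "(\<beta> + J) * T \<le> 27/50"
  shows "summable (\<lambda>n. norm (magnus A (n + 5) T))"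
    and "(\<Sum>n. norm (magnus A (n + 5) T)) \<le> 9.43 * (J * T) * ((\<beta> + J) * T) ^ 4"
proof -
  define x where "x = (\<beta> + J) * T"
  have x: "0 \<le> x" "x \<le> 27/50" using assms \<beta>_nonneg J_nonneg T_nonneg by (auto simp: x_def)
  have "(\<Sum>n<N. norm (magnus A (n + 5) T)) \<le> 9.43 * (J * T) * x ^ 4" for N
  proof -
    have "(\<Sum>n<N. norm (magnus A (n + 5) T)) \<le> (\<Sum>n<N. J * T * x ^ 4 * (majorant (n + 5) * x ^ n))"
    proof (rule sum_mono)
      fix n
      have "norm (magnus A (n + 5) T) \<le> majorant (n + 5) * J * (\<beta> + J) ^ (n + 4) * T ^ (n + 5)"
        using magnus_norm(1)[of "n + 5" T] T_nonneg by (simp add: add.commute)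
      also have "\<dots> = J * T * x ^ 4 * (majorant (n + 5) * x ^ n)"
        by (simp add: x_def power_mult_distrib power_add eval_nat_numeral mult_ac)
      finally show "norm (magnus A (n + 5) T) \<le> J * T * x ^ 4 * (majorant (n + 5) * x ^ n)" .
    qed
    also have "\<dots> = J * T * x ^ 4 * (\<Sum>n<N. majorant (n + 5) * x ^ n)"
      by (simp add: sum_distrib_left)
    also have "\<dots> \<le> J * T * x ^ 4 * 9.43"
      using x J_nonneg T_nonneg by (intro mult_left_mono majorant_tail) auto
    finally show ?thesis by (simp add: mult_ac)
  qed
  note bound = this
  show "summable (\<lambda>n. norm (magnus A (n + 5) T))"
    by (rule summableI_nonneg_bounded[OF _ bound]) simp
  from suminf_le_const[OF this bound]
  show "(\<Sum>n. norm (magnus A (n + 5) T)) \<le> 9.43 * (J * T) * ((\<beta> + J) * T) ^ 4"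
    by (simp add: x_def)
qed

end

section \<open>Comparison of the evolutions\<close>

lemma exp_scaleR_mult:
  fixes B :: "'a::{banach, real_normed_algebra_1}"
  shows "exp (r *\<^sub>R B) * exp (s *\<^sub>R B) = exp ((r + s) *\<^sub>R B)"
  by (simp add: scaleR_add_left exp_add_commuting)

lemma norm_mult3_le:
  fixes X Y Z :: "'a::real_normed_algebra"
  assumes "norm X \<le> 1" "norm Z \<le> 1"
  shows "norm (X * Y * Z) \<le> norm Y"
proof -
  have "norm (X * Y * Z) \<le> norm X * norm Y * norm Z"
    by (meson norm_mult_ineq mult_right_mono norm_ge_zero order_trans)
  also have "\<dots> \<le> 1 * norm Y * 1" using assms by (intro mult_mono) auto
  finally show ?thesis by simp
qed

text \<open>The derivative of the conjugated \<open>E\<close> along \<open>s\<close> is the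
  conjugate of [E, B], whose norm is at most 2\<beta>J.\<close>

lemma exp_conj_diff_le:
  fixes B E :: "'a::{banach, real_normed_algebra_1}"
  assumes r: "0 \<le> r" and iso: "\<And>s. norm (exp (s *\<^sub>R B)) \<le> 1"
    and "norm B \<le> \<beta>" "norm E \<le> J"
  shows "norm (exp ((- r) *\<^sub>R B) * E * exp (r *\<^sub>R B) - E) \<le> 2 * \<beta> * J * r"
proof -
  let ?f = "\<lambda>s. exp (s *\<^sub>R (- B)) * E * exp (s *\<^sub>R B)"
  let ?f' = "\<lambda>s. exp (s *\<^sub>R (- B)) * commutator E B * exp (s *\<^sub>R B)"
  have "(?f has_vector_derivative ?f' s) (at s within {0..r})" for s
  proof -
    have "(?f has_vector_derivative
        exp (s *\<^sub>R (- B)) * E * (B * exp (s *\<^sub>R B))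
        + (exp (s *\<^sub>R (- B)) * 0 + exp (s *\<^sub>R (- B)) * (- B) * E) * exp (s *\<^sub>R B)) (at s within {0..r})"
      by (intro has_vector_derivative_mult has_vector_derivative_const
        exp_scaleR_has_vector_derivative_right
        has_vector_derivative_at_within[OF exp_scaleR_has_vector_derivative_left])
    then show ?thesis by (simp add: commutator_def algebra_simps)
  qed
  then have "(?f' has_integral ?f r - ?f 0) {0..r}"
    by (intro fundamental_theorem_of_calculus r)
  moreover have "((\<lambda>s. 2 * \<beta> * J) has_integral r * (2 * \<beta> * J)) {0..r}"
    using has_integral_const_real[of "2 * \<beta> * J" 0 r] r by simp
  moreover have "norm (?f' s) \<le> 2 * \<beta> * J" for s
  proof -
    have "norm (?f' s) \<le> norm (commutator E B)"
      using iso[of "- s"] iso[of s] by (intro norm_mult3_le) auto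
    also have "\<dots> \<le> 2 * J * \<beta>" by (intro norm_commutator_le assms)
    finally show ?thesis by (simp add: mult_ac)
  qed
  ultimately have "norm (?f r - ?f 0) \<le> r * (2 * \<beta> * J)"
    by (rule has_integral_norm_le)
  then show ?thesis by (simp add: mult_ac)
qed

lemma exp_conj_diff_abs_le:
  fixes B E :: "'a::{banach, real_normed_algebra_1}"
  assumes iso: "\<And>s. norm (exp (s *\<^sub>R B)) \<le> 1" and "norm B \<le> \<beta>" "norm E \<le> J"
  shows "norm (exp ((- r) *\<^sub>R B) * E * exp (r *\<^sub>R B) - E) \<le> 2 * \<beta> * J * \<bar>r\<bar>"
proof (cases "0 \<le> r")
  case True
  then show ?thesis using exp_conj_diff_le[OF True assms] by simp
next
  case False
  have "norm (exp (s *\<^sub>R (- B))) \<le> 1" for s using iso[of "- s"] by simp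
  then show ?thesis
    using exp_conj_diff_le[of "- r" "- B" \<beta> E J] False assms by simp
qed

text \<open>No Magnus series is needed to compare the two evolutions. In the frame rotating with \<open>B\<close> and
  centred at the midpoint \<open>T / 2\<close>, the evolution \<open>W\<close> is generated by the rotated \<open>E\<close>, which
  differs from \<open>E t\<close> by at most \<open>\<beta>J\<bar>2t - T\<bar>\<close>, and \<open>\<parallel>W t - 1\<parallel> \<le> Jt\<close>.\<close>

lemma evolution_diff_le:
  fixes A E V :: "real \<Rightarrow> 'a::{banach, real_normed_algebra_1}"
  assumes "perturbed_generator A E B T \<beta> J"
    and V': "\<And>t. t \<in> {0..T} \<Longrightarrow> (V has_vector_derivative A t * V t) (at t within {0..T})"
    and V_0: "V 0 = 1" and V_norm: "\<And>t. t \<in> {0..T} \<Longrightarrow> norm (V t) \<le> 1"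
    and iso: "\<And>r. norm (exp (r *\<^sub>R B)) \<le> 1"
  shows "norm (V T - exp (T *\<^sub>R B)) \<le> norm (integral {0..T} E) + 1/2 * (J * T) * ((\<beta> + J) * T)"
proof -
  interpret perturbed_generator A E B T \<beta> J by fact
  define X where "X r = exp (r *\<^sub>R B)" for r
  have X_mult: "X r * X s = X (r + s)" for r s by (simp add: X_def exp_scaleR_mult)
  have X_0: "X 0 = 1" by (simp add: X_def)
  have X_norm: "norm (X r) \<le> 1" for r using iso by (simp add: X_def)
  \<comment> \<open>Centring at T/2 halves the time integral of the rotation angle compared with a
    frame starting at 0. This makes the \<beta> part carry the same factor 1/2 as the
    \<open>J\<close> part.\<close>
  define R where "R t = X (- (t - T / 2)) * E t * X (t - T / 2)" for t
  define W where "W t = X (T / 2 - t) * V t * X (- (T / 2))" for t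
  have W_0: "W 0 = 1" by (simp add: W_def V_0 X_mult X_0)
  have R_norm: "norm (R t) \<le> J" if "t \<in> {0..T}" for t
    using norm_mult3_le[OF X_norm X_norm] E_norm[OF that] unfolding R_def by (rule order_trans)
  have W_norm: "norm (W t) \<le> 1" if "t \<in> {0..T}" for t
    using norm_mult3_le[OF X_norm X_norm] V_norm[OF that] unfolding W_def by (rule order_trans)
  have W': "(W has_vector_derivative R t * W t) (at t within {0..T})" if t: "t \<in> {0..T}" for t
  proof -
    have "((\<lambda>t. T / 2 - t) has_vector_derivative - 1) (at t within {0..T})"
      by (auto intro!: derivative_eq_intros)
    moreover have "(X has_vector_derivative X (T / 2 - t) * B)
        (at (T / 2 - t) within (\<lambda>t. T / 2 - t) ` {0..T})"
      unfolding X_def by (rule exp_scaleR_has_vector_derivative_right)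
    ultimately have "((\<lambda>t. X (T / 2 - t)) has_vector_derivative (- 1) *\<^sub>R (X (T / 2 - t) * B)) (at t within {0..T})"
      using vector_diff_chain_within[of "\<lambda>t. T / 2 - t" "- 1" t "{0..T}" X]
      by (simp only: o_def)
    then have "(W has_vector_derivative
        X (T / 2 - t) * V t * 0
        + (X (T / 2 - t) * (A t * V t) + (- 1) *\<^sub>R (X (T / 2 - t) * B) * V t) * X (- (T / 2))) (at t within {0..T})"
      unfolding W_def by (intro has_vector_derivative_mult has_vector_derivative_const V' t)
    also have "X (T / 2 - t) * V t * 0
        + (X (T / 2 - t) * (A t * V t) + (- 1) *\<^sub>R (X (T / 2 - t) * B) * V t) * X (- (T / 2))
      = X (T / 2 - t) * E t * 1 * V t * X (- (T / 2))"
      by (simp add: A_eq[OF t] algebra_simps)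
    \<comment> \<open>The factor 1 was kept in the previous expression in order to split it here
      between \<open>R t\<close> and \<open>W t\<close>.\<close>
    also have "1 = X (t - T / 2) * X (T / 2 - t)" by (simp add: X_mult X_0)
    also have "X (T / 2 - t) * E t * (X (t - T / 2) * X (T / 2 - t)) * V t * X (- (T / 2)) = R t * W t"
      by (simp add: R_def W_def mult.assoc)
    finally show ?thesis .
  qed
  have W_near: "norm (W t - 1) \<le> J * t" if t: "t \<in> {0..T}" for t
  proof -
    have "((\<lambda>s. R s * W s) has_integral W t - W 0) {0..t}"
      using t by (intro fundamental_theorem_of_calculus has_vector_derivative_within_subset[OF W']) auto
    moreover have "((\<lambda>s. J) has_integral t * J) {0..t}"
      using has_integral_const_real[of J 0 t] t by simp
    moreover have "norm (R s * W s) \<le> J" if "s \<in> {0..t}" for s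
    proof -
      have "norm (R s * W s) \<le> norm (R s) * norm (W s)" by (rule norm_mult_ineq)
      also have "\<dots> \<le> J * 1" using that t J_nonneg by (intro mult_mono R_norm W_norm) auto
      finally show ?thesis by simp
    qed
    ultimately have "norm (W t - W 0) \<le> t * J" by (rule has_integral_norm_le)
    then show ?thesis by (simp add: W_0 mult.commute)
  qed
  have "norm ((W T - W 0) - integral {0..T} E) \<le> \<beta> * J * (T\<^sup>2 / 2) + J\<^sup>2 * (T\<^sup>2 / 2)"
  proof (rule has_integral_norm_le)
    show "((\<lambda>t. R t * W t - E t) has_integral W T - W 0 - integral {0..T} E) {0..T}"
      by (intro has_integral_diff fundamental_theorem_of_calculus W' T_nonneg
        integrable_integral integrable_continuous_real E_cont)
    have "((\<lambda>t. t) has_integral T\<^sup>2 / 2 - 0\<^sup>2 / 2) {0..T}"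
      using T_nonneg by (intro has_integral_real_antideriv) (auto intro!: derivative_eq_intros)
    then show "((\<lambda>t. \<beta> * J * \<bar>2 * t - T\<bar> + J\<^sup>2 * t) has_integral
        \<beta> * J * (T\<^sup>2 / 2) + J\<^sup>2 * (T\<^sup>2 / 2)) {0..T}"
      using T_nonneg by (intro has_integral_add has_integral_mult_right has_integral_abs_moments(1)) auto
  next
    fix t assume t: "t \<in> {0..T}"
    have "norm (R t - E t) \<le> 2 * \<beta> * J * \<bar>t - T / 2\<bar>"
      unfolding R_def X_def by (intro exp_conj_diff_abs_le iso B_norm E_norm t)
    also have "\<dots> = \<beta> * J * \<bar>2 * t - T\<bar>"
    proof -
      have "\<bar>2 * t - T\<bar> = 2 * \<bar>t - T / 2\<bar>" by (simp add: abs_if)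
      then show ?thesis by simp
    qed
    finally have "norm (R t - E t) \<le> \<beta> * J * \<bar>2 * t - T\<bar>" .
    moreover have "norm (R t * (W t - 1)) \<le> J * (J * t)"
      using t J_nonneg by (intro order_trans[OF norm_mult_ineq] mult_mono R_norm W_near) auto
    moreover have "R t * W t - E t = (R t - E t) + R t * (W t - 1)" by (simp add: algebra_simps)
    ultimately show "norm (R t * W t - E t) \<le> \<beta> * J * \<bar>2 * t - T\<bar> + J\<^sup>2 * t"
      by (metis norm_triangle_mono power2_eq_square mult.assoc)
  qed
  then have "norm (W T - 1) \<le> norm (integral {0..T} E) + 1/2 * (J * T) * ((\<beta> + J) * T)"
    using norm_triangle_ineq2[of "W T - 1" "integral {0..T} E"]
    by (simp add: W_0 power2_eq_square algebra_simps add_divide_distrib)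
  \<comment> \<open>The half rotations are undone on both sides; they are contractions, so the bound
    on \<open>W T - 1\<close> carries over.\<close>
  moreover have "V T - exp (T *\<^sub>R B) = X (T / 2) * (W T - 1) * X (T / 2)"
  proof -
    have "X (T / 2) * W T * X (T / 2) = (X (T / 2) * X (T / 2 - T)) * V T * (X (- (T / 2)) * X (T / 2))"
      by (simp add: W_def mult.assoc)
    also have "\<dots> = V T" unfolding X_mult by (simp add: X_0)
    finally have "X (T / 2) * W T * X (T / 2) = V T" .
    moreover have "X (T / 2) * X (T / 2) = exp (T *\<^sub>R B)" unfolding X_mult by (simp add: X_def)
    ultimately show ?thesis by (simp add: right_diff_distrib left_diff_distrib)
  qed
  ultimately show ?thesis using norm_mult3_le[OF X_norm X_norm, of "T / 2" "W T - 1" "T / 2"] by simp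
qed

section \<open>Operators on a Hilbert space\<close>

lemma bop_scaleC_mult:
  fixes A C :: "'a::hilbert_space bop"
  shows "(c *\<^sub>C A) * C = c *\<^sub>C (A * C)" "A * (c *\<^sub>C C) = c *\<^sub>C (A * C)"
  by (rule bop_eqI; simp add: bop_apply_scaleC)+

lemma norm_scaleC_bop_le:
  fixes A :: "'a::hilbert_space bop"
  assumes "cmod c = 1"
  shows "norm (c *\<^sub>C A) \<le> norm A"
  by (rule norm_bop_bound) (simp_all add: norm_scaleC assms norm_bop_apply)

lemma bounded_linear_scaleC_bop: "bounded_linear (\<lambda>A :: 'a::hilbert_space bop. c *\<^sub>C A)"
proof (rule bounded_linear_intro[where K = "cmod c"])
  fix A C :: "'a bop" and r :: real
  show "c *\<^sub>C (A + C) = c *\<^sub>C A + c *\<^sub>C C" by (rule scaleC_add_right)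
  show "c *\<^sub>C r *\<^sub>R A = r *\<^sub>R c *\<^sub>C A" by (rule scaleC_scaleR_commute)
  show "norm (c *\<^sub>C A) \<le> norm A * cmod c"
  proof (rule norm_bop_bound)
    fix x
    show "norm ((c *\<^sub>C A) *\<^sub>V x) \<le> norm A * cmod c * norm x"
      using mult_left_mono[OF norm_bop_apply[of A x], of "cmod c"] by (simp add: norm_scaleC mult_ac)
  qed simp
qed

text \<open>Provides the product rule for Re<u, u>. The Cauchy-Schwarz bound is read off from the
  triangle inequality by expanding the square of the norm of x + y.\<close>

lemma bounded_bilinear_Re_cinner: "bounded_bilinear (\<lambda>x y :: 'a::hilbert_space. Re (cinner x y))"
proof -
  have add: "Re (cinner (x + y) z) = Re (cinner x z) + Re (cinner y z)"
    "Re (cinner z (x + y)) = Re (cinner z x) + Re (cinner z y)" for x y z :: 'a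
    by (simp_all add: cinner_add_left cinner_add_right)
  have scale: "Re (cinner (r *\<^sub>R x) z) = r * Re (cinner x z)"
    "Re (cinner z (r *\<^sub>R x)) = r * Re (cinner z x)" for r and x z :: 'a
    by (simp_all add: scaleR_scaleC cinner_scaleC_left cinner_scaleC_right)
  have self: "Re (cinner x x) = (norm x)\<^sup>2" for x :: 'a
    by (simp add: cinner_norm)
  have upper: "Re (cinner x y) \<le> norm x * norm y" for x y :: 'a
  proof -
    have sym: "Re (cinner y x) = Re (cinner x y)"
      by (subst cinner_commute) simp
    have "(norm (x + y))\<^sup>2 \<le> (norm x + norm y)\<^sup>2"
      by (intro power_mono norm_triangle_ineq norm_ge_zero)
    moreover have "(norm (x + y))\<^sup>2 = (norm x)\<^sup>2 + (norm y)\<^sup>2 + 2 * Re (cinner x y)"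
      unfolding self[symmetric] add using sym by simp
    ultimately show ?thesis by (simp add: power2_sum)
  qed
  have "\<bar>Re (cinner x y)\<bar> \<le> norm x * norm y" for x y :: 'a
    using upper[of x y] upper[of "(- 1) *\<^sub>R x" y] unfolding scale by simp
  then show ?thesis
    by unfold_locales (auto simp: add scale intro!: exI[of _ 1])
qed

text \<open>Energy argument on each orbit u(s) = V(s) x: the squared norm has derivative 2 Re<u, X
  u> = 0.\<close>

lemma norm_skew_evolution:
  fixes V X :: "real \<Rightarrow> 'a::hilbert_space bop"
  assumes skew: "\<And>t u. t \<in> {0..T} \<Longrightarrow> Re (cinner u (X t *\<^sub>V u)) = 0"
    and V': "\<And>t. t \<in> {0..T} \<Longrightarrow> (V has_vector_derivative X t * V t) (at t within {0..T})"
    and "V 0 = 1" and t: "t \<in> {0..T}"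
  shows "norm (V t) \<le> 1"
proof (rule norm_bop_bound)
  fix x
  interpret bounded_bilinear "\<lambda>x y :: 'a. Re (cinner x y)" by (rule bounded_bilinear_Re_cinner)
  define u where "u s = V s *\<^sub>V x" for s
  have eval_x: "bounded_linear (\<lambda>A. A *\<^sub>V x)"
    by (rule bounded_linear_intro[where K = "norm x"]) (simp_all add: norm_bop_apply)
  have u': "(u has_vector_derivative X s *\<^sub>V u s) (at s within {0..t})" if s: "s \<in> {0..t}" for s
  proof -
    have "(V has_vector_derivative X s * V s) (at s within {0..t})"
      using s t by (intro has_vector_derivative_within_subset[OF V']) auto
    from bounded_linear.has_vector_derivative[OF eval_x this] show ?thesis by (simp add: u_def[abs_def])
  qed
  have "((\<lambda>s. Re (cinner (u s) (u s))) has_vector_derivative 0) (at s within {0..t})"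
    if s: "s \<in> {0..t}" for s
  proof -
    have "Re (cinner (u s) (X s *\<^sub>V u s)) = 0" "Re (cinner (X s *\<^sub>V u s) (u s)) = 0"
      using skew[of s "u s"] s t by (auto simp: cinner_commute[of "X s *\<^sub>V u s" "u s"])
    then show ?thesis using has_vector_derivative[OF u'[OF s] u'[OF s]] by simp
  qed
  then have "((\<lambda>s. 0) has_integral Re (cinner (u t) (u t)) - Re (cinner (u 0) (u 0))) {0..t}"
    by (intro fundamental_theorem_of_calculus) (use t in auto)
  then have "Re (cinner (u t) (u t)) - Re (cinner (u 0) (u 0)) = 0"
    by (rule has_integral_unique) simp
  then have "(norm (u t))\<^sup>2 = (norm x)\<^sup>2" using assms(3) by (simp add: cinner_norm u_def)
  then show "norm (V t *\<^sub>V x) \<le> 1 * norm x" by (simp add: power2_eq_iff_nonneg u_def)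
qed simp

lemma norm_exp_skew:
  fixes B :: "'a::hilbert_space bop"
  assumes skew: "\<And>u. Re (cinner u (B *\<^sub>V u)) = 0"
  shows "norm (exp (r *\<^sub>R B)) \<le> 1"
proof -
  have pos: "norm (exp (r *\<^sub>R B)) \<le> 1"
    if "0 \<le> r" "\<And>u. Re (cinner u (B *\<^sub>V u)) = 0" for r and B :: "'a bop"
    by (rule norm_skew_evolution[of r "\<lambda>_. B"])
      (use that in \<open>auto intro: has_vector_derivative_at_within exp_scaleR_has_vector_derivative_left\<close>)
  interpret bounded_bilinear "\<lambda>x y :: 'a. Re (cinner x y)" by (rule bounded_bilinear_Re_cinner)
  show ?thesis
  proof (cases "0 \<le> r")
    case False
    then show ?thesis using pos[of "- r" "- B"] skew by (simp add: minus_right)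
  qed (use pos skew in simp)
qed

lemma Re_cinner_hermitian:
  assumes "hermitian H"
  shows "Re (cinner u (((- \<i>) *\<^sub>C H) *\<^sub>V u)) = 0"
proof -
  have "cinner u (H *\<^sub>V u) = cnj (cinner u (H *\<^sub>V u))"
    using assms unfolding hermitian_def by (metis cinner_commute)
  then have "Im (cinner u (H *\<^sub>V u)) = 0" by (simp add: complex_eq_iff)
  then show ?thesis by (simp add: cinner_scaleC_right)
qed

section \<open>Conjugation by unitaries\<close>

lemma unitary_norm:
  assumes "unitary U"
  shows "norm U \<le> 1" "norm (adj U) \<le> 1"
proof -
  have norm_U: "norm (U *\<^sub>V x) = norm x" for x
  proof -
    have "complex_of_real ((norm (U *\<^sub>V x))\<^sup>2) = complex_of_real ((norm x)\<^sup>2)"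
      unfolding cinner_norm[symmetric] using assms by (simp add: unitary_def)
    then have "(norm (U *\<^sub>V x))\<^sup>2 = (norm x)\<^sup>2" using of_real_eq_iff by blast
    then show ?thesis by (simp add: power2_eq_iff_nonneg)
  qed
  then show "norm U \<le> 1" by (intro norm_bop_bound) auto
  have "norm (adj U *\<^sub>V x) = norm x" for x
    using norm_U[of "adj U *\<^sub>V x"] unitary_adj(2)[OF assms] by (metis bop_apply_simps(2,8))
  then show "norm (adj U) \<le> 1" by (intro norm_bop_bound) auto
qed

lemma hermitian_conjugate:
  assumes "unitary U" "hermitian H"
  shows "hermitian (conjugate U H)"
  unfolding hermitian_def
proof (intro allI)
  fix x y
  have "cinner (conjugate U H *\<^sub>V x) y = cinner (U *\<^sub>V x) (H *\<^sub>V (U *\<^sub>V y))"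
    using assms by (simp add: conjugate_def unitary_adj(3) hermitian_def)
  also have "\<dots> = cnj (cinner (adj U *\<^sub>V (H *\<^sub>V (U *\<^sub>V y))) x)"
    using assms(1) by (metis unitary_adj(3) cinner_commute)
  finally show "cinner (conjugate U H *\<^sub>V x) y = cinner x (conjugate U H *\<^sub>V y)"
    by (simp add: conjugate_def flip: cinner_commute)
qed

lemma norm_conjugate_le:
  assumes "unitary U"
  shows "norm (conjugate U X) \<le> norm X"
proof -
  have "norm (adj U * X * U) \<le> norm (adj U) * norm X * norm U"
    by (meson norm_mult_ineq mult_right_mono norm_ge_zero order_trans)
  also have "\<dots> \<le> 1 * norm X * 1" using unitary_norm[OF assms] by (intro mult_mono) auto
  finally show ?thesis by (simp add: conjugate_def)
qed

text \<open>On unitaries the adjoint is the inverse, and adj U - adj V = adj U (V - U) adj V makes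
  it 1-Lipschitz in operator norm.\<close>

lemma continuous_on_conjugate:
  fixes U :: "real \<Rightarrow> 'a::hilbert_space bop"
  assumes U: "\<And>t. t \<in> S \<Longrightarrow> unitary (U t)" and cont: "continuous_on S U"
  shows "continuous_on S (\<lambda>t. conjugate (U t) X)"
proof -
  have lipschitz: "dist (adj (U s)) (adj (U t)) \<le> dist (U s) (U t)" if "s \<in> S" "t \<in> S" for s t
  proof -
    have "adj (U s) - adj (U t) = adj (U s) * (U t - U s) * adj (U t)"
      using unitary_adj(1)[OF U[OF that(1)]] unitary_adj(2)[OF U[OF that(2)]]
      by (simp add: right_diff_distrib left_diff_distrib mult.assoc)
    also have "norm \<dots> \<le> norm (adj (U s)) * norm (U t - U s) * norm (adj (U t))"
      by (meson norm_mult_ineq mult_right_mono norm_ge_zero order_trans)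
    also have "\<dots> \<le> 1 * norm (U t - U s) * 1"
      using unitary_norm[OF U[OF that(1)]] unitary_norm[OF U[OF that(2)]] by (intro mult_mono) auto
    finally show ?thesis by (simp add: dist_norm norm_minus_commute)
  qed
  have "continuous_on S (\<lambda>t. adj (U t))"
    unfolding continuous_on_iff
  proof (intro ballI allI impI)
    fix t and e :: real assume t: "t \<in> S" and "0 < e"
    then obtain d where "d > 0" "\<And>s. s \<in> S \<Longrightarrow> dist s t < d \<Longrightarrow> dist (U s) (U t) < e"
      using cont unfolding continuous_on_iff by blast
    then show "\<exists>d>0. \<forall>s\<in>S. dist s t < d \<longrightarrow> dist (adj (U s)) (adj (U t)) < e"
      using lipschitz[OF _ t] by (meson le_less_trans)
  qed
  then show ?thesis unfolding conjugate_def by (intro continuous_intros cont)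
qed

section \<open>Operators on the tensor product\<close>

lemma hilbert_tensor_eqI:
  assumes "hilbert_tensor tens" "\<And>x y. A *\<^sub>V tens x y = C *\<^sub>V tens x y"
  shows "A = C"
proof (rule bop_eqI)
  fix z
  interpret A: bounded_linear "bop_apply A" by (rule bounded_linear_bop_apply)
  interpret C: bounded_linear "bop_apply C" by (rule bounded_linear_bop_apply)
  have "A *\<^sub>V z = C *\<^sub>V z" if "z \<in> span (range (\<lambda>(x, y). tens x y))" for z
    by (rule linear_eq_on_span[OF A.linear_axioms C.linear_axioms _ that]) (use assms(2) in auto)
  then have "span (range (\<lambda>(x, y). tens x y)) \<subseteq> {z. A *\<^sub>V z = C *\<^sub>V z}" by blast
  moreover have "closed {z. A *\<^sub>V z = C *\<^sub>V z}"
    by (intro closed_Collect_eq linear_continuous_on bounded_linear_bop_apply)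
  ultimately have "closure (span (range (\<lambda>(x, y). tens x y))) \<subseteq> {z. A *\<^sub>V z = C *\<^sub>V z}"
    by (rule closure_minimal)
  then show "A *\<^sub>V z = C *\<^sub>V z" using assms(1) unfolding hilbert_tensor_def by blast
qed

text \<open>An operator on the system alone commutes with one on the bath alone, as both orders
  agree on product vectors. Hence the toggling frame leaves \<open>HB\<close> fixed.\<close>

lemma conjugate_bath:
  assumes "hilbert_tensor tens" "is_op_tensor tens 1 B0 HB" "acts_on_system tens U" "unitary U"
  shows "conjugate U HB = HB"
proof -
  obtain A where A: "is_op_tensor tens A 1 U" using assms(3) by (auto simp: acts_on_system_def)
  have "HB * U = U * HB"
    using assms(2) A by (intro hilbert_tensor_eqI[OF assms(1)]) (simp add: is_op_tensor_def)
  then have "adj U * HB * U = (adj U * U) * HB" by (simp add: mult.assoc)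
  then show ?thesis using unitary_adj(1)[OF assms(4)] by (simp add: conjugate_def)
qed

section \<open>Pulse trains\<close>

text \<open>Only norms and integrals matter here, so the toggled error is an abstract path
  \<open>E\<close> in a Banach space, equal to \<open>H k\<close> between pulses \<open>k\<close>
  and \<open>k + 1\<close> and merely bounded by \<open>J\<close> during a pulse. \<open>H_N\<close>
  records that the memory sequence is cyclic.\<close>

locale pulse_train =
  fixes N :: nat and \<delta> t0 J :: real and s :: "nat \<Rightarrow> real"
    and E :: "real \<Rightarrow> 'a::banach" and H :: "nat \<Rightarrow> 'a"
  assumes N_pos: "1 \<le> N" and \<delta>_pos: "0 < \<delta>" and s_1: "0 \<le> s 1"
    and s_Suc: "\<And>k. k \<in> {1..<N} \<Longrightarrow> s k + \<delta> \<le> s (Suc k)"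
    and s_N: "s N + \<delta> = t0"
    and E_cont: "continuous_on {0..t0} E"
    and E_0: "\<And>t. t \<in> {0..s 1} \<Longrightarrow> E t = H 0"
    and E_between: "\<And>k t. k \<in> {1..<N} \<Longrightarrow> t \<in> {s k + \<delta>..s (Suc k)} \<Longrightarrow> E t = H k"
    and E_norm: "\<And>t. t \<in> {0..t0} \<Longrightarrow> norm (E t) \<le> J"
    and H_norm: "\<And>k. k \<le> N \<Longrightarrow> norm (H k) \<le> J"
    and H_N: "H N = H 0"
    and decoupled: "((\<lambda>t. H (card {j \<in> {1..N}. s j \<le> t})) has_integral 0) {0..t0}"
begin

lemma s_mono:
  assumes "1 \<le> i" "i \<le> j" "j \<le> N"
  shows "s i \<le> s j"
  using assms(2,3)
proof (induction j rule: dec_induct)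
  case (step j)
  then show ?case using assms(1) s_Suc[of j] \<delta>_pos by simp
qed simp

lemma s_range: "k \<in> {1..N} \<Longrightarrow> 0 \<le> s k \<and> s k + \<delta> \<le> t0"
  using s_mono[of 1 k] s_mono[of k N] s_1 s_N by auto

definition ideal :: "real \<Rightarrow> 'a"
  where "ideal t = H (card {j \<in> {1..N}. s j \<le> t})"

lemma ideal_eq:
  assumes "k \<le> N" "k \<ge> 1 \<Longrightarrow> s k \<le> t" "k < N \<Longrightarrow> t < s (Suc k)"
  shows "ideal t = H k"
proof -
  have "s j \<le> t \<longleftrightarrow> j \<le> k" if "j \<in> {1..N}" for j
  proof
    assume "j \<le> k"
    then show "s j \<le> t" using assms s_mono[of j k] that by fastforce
  next
    assume "s j \<le> t"
    then show "j \<le> k"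
      using assms s_mono[of "Suc k" j] that by (cases "j \<le> k") auto
  qed
  then have "{j \<in> {1..N}. s j \<le> t} = {1..k}" using assms(1) by auto
  then show ?thesis by (simp add: ideal_def)
qed

lemma ideal_integral:
  assumes "k \<in> {1..N}"
  shows "(ideal has_integral s 1 *\<^sub>R H 0 + (\<Sum>j\<in>{1..<k}. (s (Suc j) - s j) *\<^sub>R H j)) {0..s k}"
  using assms
proof (induction k rule: nat_induct)
  case (Suc k)
  show ?case
  proof (cases "k = 0")
    case True
    have "((\<lambda>_. H 0) has_integral s 1 *\<^sub>R H 0) {0..s 1}"
      using has_integral_const_real[of "H 0" 0 "s 1"] s_1 by simp
    \<comment> \<open>The segments are half-open: at its right end the ideal path already has the
      next value, which changes a single point.\<close>
    then have "(ideal has_integral s 1 *\<^sub>R H 0) {0..s 1}"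
      by (rule has_integral_spike_finite[of "{s 1}", rotated 2]) (use N_pos in \<open>auto intro!: ideal_eq\<close>)
    then show ?thesis using True by simp
  next
    case False
    have "((\<lambda>_. H k) has_integral (s (Suc k) - s k) *\<^sub>R H k) {s k..s (Suc k)}"
      using has_integral_const_real[of "H k" "s k" "s (Suc k)"] s_mono[of k "Suc k"] Suc.prems False by simp
    then have "(ideal has_integral (s (Suc k) - s k) *\<^sub>R H k) {s k..s (Suc k)}"
      by (rule has_integral_spike_finite[of "{s (Suc k)}", rotated 2])
        (use Suc.prems in \<open>auto intro!: ideal_eq\<close>)
    moreover have "(ideal has_integral s 1 *\<^sub>R H 0 + (\<Sum>j\<in>{1..<k}. (s (Suc j) - s j) *\<^sub>R H j)) {0..s k}"
      using Suc False by simp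
    ultimately have "(ideal has_integral s 1 *\<^sub>R H 0 + (\<Sum>j\<in>{1..<k}. (s (Suc j) - s j) *\<^sub>R H j)
        + (s (Suc k) - s k) *\<^sub>R H k) {0..s (Suc k)}"
      using Suc.prems False s_range[of k] s_mono[of k "Suc k"]
      by (intro has_integral_combine[of 0 "s k" "s (Suc k)"]) auto
    then show ?thesis using False by (simp add: add.assoc)
  qed
qed simp

lemma ideal_sum: "s 1 *\<^sub>R H 0 + (\<Sum>j\<in>{1..<N}. (s (Suc j) - s j) *\<^sub>R H j) + \<delta> *\<^sub>R H N = 0"
proof -
  have "((\<lambda>_. H N) has_integral \<delta> *\<^sub>R H N) {s N..t0}"
    using has_integral_const_real[of "H N" "s N" t0] \<delta>_pos by (simp flip: s_N)
  then have "(ideal has_integral \<delta> *\<^sub>R H N) {s N..t0}"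
    by (rule has_integral_spike_finite[of "{}", rotated 2]) (auto intro!: ideal_eq)
  then have "(ideal has_integral s 1 *\<^sub>R H 0 + (\<Sum>j\<in>{1..<N}. (s (Suc j) - s j) *\<^sub>R H j) + \<delta> *\<^sub>R H N) {0..t0}"
    using ideal_integral[of N] N_pos s_range[of N] \<delta>_pos
    by (intro has_integral_combine[of 0 "s N" t0]) auto
  moreover have "(ideal has_integral 0) {0..t0}" using decoupled by (simp add: ideal_def[abs_def])
  ultimately show ?thesis by (rule has_integral_unique)
qed

abbreviation pulse :: "nat \<Rightarrow> 'a"
  where "pulse k \<equiv> integral {s k..s k + \<delta>} E"

lemma E_integrable: "0 \<le> a \<Longrightarrow> b \<le> t0 \<Longrightarrow> E integrable_on {a..b}"
  by (rule integrable_continuous_real[OF continuous_on_subset[OF E_cont]]) auto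

lemma E_integral:
  assumes "k \<in> {1..N}"
  shows "integral {0..s k} E
    = s 1 *\<^sub>R H 0 + (\<Sum>j\<in>{1..<k}. pulse j + (s (Suc j) - s j - \<delta>) *\<^sub>R H j)"
  using assms
proof (induction k rule: nat_induct)
  case (Suc k)
  show ?case
  proof (cases "k = 0")
    case True
    have "integral {0..s 1} E = integral {0..s 1} (\<lambda>_. H 0)" by (rule integral_cong) (rule E_0)
    then show ?thesis using True s_1 by simp
  next
    case False
    have k: "k \<in> {1..<N}" "k \<in> {1..N}" "Suc k \<in> {1..N}" using Suc.prems False by auto
    note range = s_range[OF k(2)] s_range[OF k(3)] s_Suc[OF k(1)]
    have "integral {s k + \<delta>..s (Suc k)} E = integral {s k + \<delta>..s (Suc k)} (\<lambda>_. H k)"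
      by (rule integral_cong) (rule E_between[OF k(1)])
    also have "\<dots> = (s (Suc k) - s k - \<delta>) *\<^sub>R H k" using s_Suc[OF k(1)] by simp
    finally have "integral {s k + \<delta>..s (Suc k)} E = (s (Suc k) - s k - \<delta>) *\<^sub>R H k" .
    moreover have "integral {0..s k} E + integral {s k..s (Suc k)} E = integral {0..s (Suc k)} E"
      using range \<delta>_pos by (intro Henstock_Kurzweil_Integration.integral_combine E_integrable) auto
    moreover have "pulse k + integral {s k + \<delta>..s (Suc k)} E = integral {s k..s (Suc k)} E"
      using range \<delta>_pos by (intro Henstock_Kurzweil_Integration.integral_combine E_integrable) auto
    ultimately have "integral {0..s (Suc k)} E
        = integral {0..s k} E + (pulse k + (s (Suc k) - s k - \<delta>) *\<^sub>R H k)"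
      by simp
    then show ?thesis using False unfolding Suc.IH[OF k(2)] by (simp add: add.assoc)
  qed
qed simp

text \<open>Subtracting the vanishing ideal integral \<open>ideal_sum\<close> removes everything
  between the pulses; each pulse leaves its own integral minus the value that the ideal path has
  there.\<close>

lemma integral_eq_pulse_errors: "integral {0..t0} E = (\<Sum>k\<in>{1..N}. pulse k - \<delta> *\<^sub>R H k)"
proof -
  have "integral {0..t0} E = integral {0..s N} E + pulse N"
    using s_range[of N] N_pos \<delta>_pos s_N
    by (subst Henstock_Kurzweil_Integration.integral_combine) (auto intro!: E_integrable)
  also have "\<dots> = s 1 *\<^sub>R H 0 + (\<Sum>j\<in>{1..<N}. pulse j + (s (Suc j) - s j - \<delta>) *\<^sub>R H j) + pulse N"
    using E_integral[of N] N_pos by simp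
  also have "\<dots> = \<dots> - (s 1 *\<^sub>R H 0 + (\<Sum>j\<in>{1..<N}. (s (Suc j) - s j) *\<^sub>R H j) + \<delta> *\<^sub>R H N)"
    unfolding ideal_sum by simp
  also have "\<dots> = (\<Sum>j\<in>{1..<N}. pulse j - \<delta> *\<^sub>R H j) + (pulse N - \<delta> *\<^sub>R H N)"
    by (simp add: scaleR_diff_left sum.distrib sum_subtractf)
  also have "\<dots> = (\<Sum>k\<in>{1..N}. pulse k - \<delta> *\<^sub>R H k)"
    using N_pos by (simp add: sum.last_plus add.commute)
  finally show ?thesis .
qed

lemma pulse_norm: "k \<in> {1..N} \<Longrightarrow> norm (pulse k) \<le> \<delta> * J"
proof -
  assume k: "k \<in> {1..N}"
  have "norm (pulse k) \<le> J * (s k + \<delta> - s k)"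
    using s_range[OF k] \<delta>_pos
    by (intro integral_bound continuous_on_subset[OF E_cont] E_norm) auto
  then show ?thesis by (simp add: mult.commute)
qed

lemma integral_norm: "norm (integral {0..t0} E) \<le> 2 * real N * \<delta> * J"
proof -
  have "norm (integral {0..t0} E) \<le> (\<Sum>k\<in>{1..N}. \<delta> * J + \<delta> * J)"
    unfolding integral_eq_pulse_errors
  proof (intro sum_norm_le norm_triangle_le_diff add_mono pulse_norm)
    fix k assume "k \<in> {1..N}"
    then show "norm (\<delta> *\<^sub>R H k) \<le> \<delta> * J" using H_norm \<delta>_pos by (simp add: mult_left_mono)
  qed
  then show ?thesis by (simp add: mult_ac)
qed

text \<open>For regularly spaced pulses decoupling says \<open>H 1 + \<dots> + H N = 0\<close>, so that the errors
  \<open>- \<delta> H k\<close> cancel.\<close>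

lemma integral_norm_regular:
  assumes "regularly_spaced N t0 s"
  shows "norm (integral {0..t0} E) \<le> real N * \<delta> * J"
proof -
  define \<tau> where "\<tau> = t0 + s 1 - s N"
  have spacing: "s (Suc k) - s k = \<tau>" if "k \<in> {1..<N}" for k
    using assms that by (auto simp: regularly_spaced_def \<tau>_def)
  \<comment> \<open>The initial segment of length \<open>s 1\<close> and the final one of length
    \<delta> both carry \<open>H 0 = H N\<close>; cyclically they join to one full spacing.\<close>
  have "\<tau> = s 1 + \<delta>" using s_N by (simp add: \<tau>_def)
  then have "\<tau> \<noteq> 0" using s_1 \<delta>_pos by simp
  have "\<tau> *\<^sub>R (\<Sum>k\<in>{1..N}. H k) = (\<Sum>j\<in>{1..<N}. \<tau> *\<^sub>R H j) + \<tau> *\<^sub>R H N"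
    using N_pos by (simp add: sum.last_plus scaleR_add_right scaleR_sum_right add.commute)
  also have "(\<Sum>j\<in>{1..<N}. \<tau> *\<^sub>R H j) = (\<Sum>j\<in>{1..<N}. (s (Suc j) - s j) *\<^sub>R H j)"
    by (rule sum.cong) (simp_all add: spacing)
  also have "\<dots> + \<tau> *\<^sub>R H N = 0"
    using ideal_sum unfolding \<open>\<tau> = s 1 + \<delta>\<close> H_N by (simp add: scaleR_add_left algebra_simps)
  finally have "(\<Sum>k\<in>{1..N}. H k) = 0" using \<open>\<tau> \<noteq> 0\<close> by simp
  then have "integral {0..t0} E = (\<Sum>k\<in>{1..N}. pulse k)"
    unfolding integral_eq_pulse_errors by (simp add: sum_subtractf flip: scaleR_sum_right)
  also have "norm \<dots> \<le> (\<Sum>k\<in>{1..N}. \<delta> * J)" by (intro sum_norm_le pulse_norm)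
  finally show ?thesis by simp
qed

end

section \<open>The main theorem\<close>

lemma unitary_pulse_prod:
  assumes "\<And>j. j \<in> {1..k} \<Longrightarrow> unitary (P j)"
  shows "unitary (pulse_prod P k)"
  using assms
proof (induction k)
  case 0
  show ?case by (simp add: unitary_def surj_def)
next
  case (Suc k)
  have U: "unitary (pulse_prod P k)" "unitary (P (Suc k))" using Suc by auto
  then have "surj (bop_apply (P (Suc k)) \<circ> bop_apply (pulse_prod P k))"
    unfolding unitary_def by (intro comp_surj) auto
  also have "bop_apply (P (Suc k)) \<circ> bop_apply (pulse_prod P k) = bop_apply (pulse_prod P (Suc k))"
    by (rule ext) simp
  finally show ?case using U by (simp add: unitary_def)
qed

text \<open>The phase cancels against its conjugate. A memory sequence that is cyclic up to a phase
  thus restores the error exactly, which gives \<open>H N = H 0\<close>.\<close>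

lemma conjugate_phase:
  assumes "cmod c = 1"
  shows "conjugate (c *\<^sub>C 1) X = X"
proof -
  have "cnj c * c = 1" using complex_norm_square[of c] assms by (simp add: mult.commute)
  moreover have "adj (c *\<^sub>C 1) = cnj c *\<^sub>C (1 :: 'a bop)"
    by (rule adj_eqI) (simp add: cinner_scaleC_left cinner_scaleC_right)
  ultimately show ?thesis
    by (simp add: conjugate_def bop_scaleC_mult scaleC_scaleC scaleC_one mult.commute)
qed

theorem mainTheorem1:
  fixes tens :: "'s::hilbert_space \<Rightarrow> 'b::hilbert_space \<Rightarrow> 'h::hilbert_space"
    and N :: nat and \<delta> t0 T \<beta> J \<epsilon> C1 :: real
    and s :: "nat \<Rightarrow> real" and P :: "nat \<Rightarrow> 'h bop" and G :: "'h bop"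
    and Uc Ut :: "real \<Rightarrow> 'h bop"
    and HB Herr :: "'h bop" and B0 :: "'b bop"
    and Om :: "nat \<Rightarrow> 'h bop"
  assumes tensor: "hilbert_tensor tens"
    and bath: "is_op_tensor tens 1 B0 HB"
    and herm: "hermitian HB" "hermitian (HB + Herr)"
    and norms: "norm HB \<le> \<beta>" "norm Herr \<le> J" "\<epsilon> = \<beta> + J"
    and control: "dd_control tens N \<delta> t0 s P G Uc"
    and decoupling: "first_order_decoupling N t0 s P Herr"
    and evolution: "evolution_on t0 (toggling Uc (HB + Herr)) Ut"
    and T: "T = t0"
    and Om: "\<And>n. Om n = magnus (\<lambda>t. (- \<i>) *\<^sub>C toggling Uc (HB + Herr) t) n T"
    and C1: "C1 = 2 * real N * \<delta> / T \<or> regularly_spaced N t0 s \<and> C1 = real N * \<delta> / T"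
  shows "norm (Om 1 + (\<i> * T) *\<^sub>C HB) \<le> dd_const C1 1 * (J * T) \<and>
    (\<forall>n\<in>{2, 3, 4}. norm (Om n) \<le> dd_const C1 n * (J * T) * (\<epsilon> * T) ^ (n - 1)) \<and>
    (\<epsilon> * T \<le> 0.54 \<longrightarrow>
      summable (\<lambda>n. norm (Om (n + 5))) \<and>
      (\<Sum>n. norm (Om (n + 5))) \<le> dd_const C1 5 * (J * T) * (\<epsilon> * T) ^ 4 \<and>
      norm (Ut t0 - exp ((- \<i> * t0) *\<^sub>C HB))
        \<le> (J * T) * (\<Sum>n = 1..5. dd_const C1 n * (\<epsilon> * T) ^ (n - 1)))"
proof -
  define A where "A t = (- \<i>) *\<^sub>C toggling Uc (HB + Herr) t" for t
  define B where "B = (- \<i>) *\<^sub>C HB"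
  define F where "F t = conjugate (Uc t) Herr" for t
  define E where "E t = (- \<i>) *\<^sub>C F t" for t
  define H where "H k = conjugate (pulse_prod P k) Herr" for k
  note control = control[unfolded dd_control_def]
  have U: "unitary (Uc t)" "acts_on_system tens (Uc t)" if "t \<in> {0..t0}" for t
    using control that by auto
  have Uc_cont: "continuous_on {0..t0} Uc"
    using control unfolding piecewise_C1_differentiable_on_def by blast
  have F_cont: "continuous_on {0..t0} F"
    unfolding F_def by (intro continuous_on_conjugate Uc_cont U)
  have conj_1: "conjugate 1 X = X" for X :: "'h bop"
    using conjugate_phase[of 1 X] by (simp add: scaleC_one)
  have conj_N: "conjugate (pulse_prod P N) X = X" for X
    using control conjugate_phase by metis
  \<comment> \<open>The pulse analysis is applied to \<open>F\<close>; the factor -\<i> is restored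
    after integration, where it does not change the norm bound.\<close>
  interpret pulse_train N \<delta> t0 J s F H
  proof
    show "norm (F t) \<le> J" if "t \<in> {0..t0}" for t
      unfolding F_def using norm_conjugate_le[OF U(1)[OF that]] norms(2) by (rule order_trans)
    show "norm (H k) \<le> J" if "k \<le> N" for k
    proof -
      have "unitary (pulse_prod P k)" using control that by (intro unitary_pulse_prod) auto
      from norm_conjugate_le[OF this] norms(2) show ?thesis unfolding H_def by (rule order_trans)
    qed
    show "((\<lambda>t. H (card {j \<in> {1..N}. s j \<le> t})) has_integral 0) {0..t0}"
      using decoupling unfolding first_order_decoupling_def ideal_err_def[abs_def] H_def .
  qed (use control F_cont conj_N in \<open>auto simp: F_def H_def conj_1\<close>)
  have T_pos: "0 < T" using s_range[of N] N_pos \<delta>_pos T by auto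
  have "perturbed_generator A E B T \<beta> J"
  proof
    show "A t = B + E t" if "t \<in> {0..T}" for t
    proof -
      have "conjugate (Uc t) HB = HB"
        using that T U[of t] by (intro conjugate_bath[OF tensor bath]) auto
      moreover have "conjugate (Uc t) (HB + Herr) = conjugate (Uc t) HB + F t"
        by (simp add: conjugate_def F_def distrib_left distrib_right)
      ultimately show ?thesis by (simp add: A_def B_def E_def toggling_def scaleC_add_right)
    qed
    show "continuous_on {0..T} E"
      unfolding E_def T by (rule bounded_linear.continuous_on[OF bounded_linear_scaleC_bop F_cont])
    show "norm B \<le> \<beta>"
      unfolding B_def using norm_scaleC_bop_le[of "- \<i>" HB] norms(1) by simp
    show "norm (E t) \<le> J" if "t \<in> {0..T}" for t
      unfolding E_def using norm_scaleC_bop_le[of "- \<i>" "F t"] E_norm[of t] that T by simp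
  qed (use T_pos in simp)
  then interpret gen: perturbed_generator A E B T \<beta> J .
  have Om: "Om n = magnus A n T" for n
    unfolding A_def by (rule Om)
  have E_integral: "norm (integral {0..T} E) \<le> C1 * (J * T)"
  proof -
    have "integral {0..T} E = (- \<i>) *\<^sub>C integral {0..t0} F"
      using integral_linear[OF integrable_continuous_real[OF F_cont] bounded_linear_scaleC_bop[of "- \<i>"]]
      by (simp add: E_def[abs_def] o_def T)
    then have "norm (integral {0..T} E) \<le> norm (integral {0..t0} F)"
      using norm_scaleC_bop_le[of "- \<i>"] by simp
    also have "\<dots> \<le> C1 * (J * T)"
      using C1 integral_norm integral_norm_regular T_pos by (auto simp: mult_ac)
    finally show ?thesis .
  qed
  have "Om 1 + (\<i> * T) *\<^sub>C HB = integral {0..T} E"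
  proof -
    have "T *\<^sub>R B = (- (\<i> * T)) *\<^sub>C HB"
      by (simp add: B_def scaleR_scaleC scaleC_scaleC mult.commute)
    moreover have "(- (\<i> * T)) *\<^sub>C HB + (\<i> * T) *\<^sub>C HB = 0"
      using scaleR_scaleC[of 0 HB] by (simp flip: scaleC_add_left)
    ultimately show ?thesis
      using gen.magnus_1_eq[of T] T_pos by (simp add: Om algebra_simps)
  qed
  with E_integral have first: "norm (Om 1 + (\<i> * T) *\<^sub>C HB) \<le> dd_const C1 1 * (J * T)"
    by (simp add: dd_const_def)
  have orders: "\<forall>n\<in>{2, 3, 4}. norm (Om n) \<le> dd_const C1 n * (J * T) * (\<epsilon> * T) ^ (n - 1)"
    using gen.magnus_2_norm gen.magnus_3_norm gen.magnus_4_norm by (simp add: Om dd_const_def norms(3))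
  have tail: "summable (\<lambda>n. norm (Om (n + 5))) \<and>
      (\<Sum>n. norm (Om (n + 5))) \<le> dd_const C1 5 * (J * T) * (\<epsilon> * T) ^ 4" if "\<epsilon> * T \<le> 0.54"
    using gen.magnus_tail that by (simp add: Om dd_const_def norms(3))
  have "norm (Ut T - exp (T *\<^sub>R B)) \<le> norm (integral {0..T} E) + 1/2 * (J * T) * ((\<beta> + J) * T)"
  proof (rule evolution_diff_le[OF gen.perturbed_generator_axioms])
    show Ut': "(Ut has_vector_derivative A t * Ut t) (at t within {0..T})" if "t \<in> {0..T}" for t
      using evolution that by (simp add: evolution_on_def A_def T bop_scaleC_mult)
    show "Ut 0 = 1" using evolution by (simp add: evolution_on_def)
    have "Re (cinner u (A t *\<^sub>V u)) = 0" if "t \<in> {0..T}" for t u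
      unfolding A_def toggling_def using that T
      by (intro Re_cinner_hermitian hermitian_conjugate U herm) auto
    from norm_skew_evolution[OF this Ut' \<open>Ut 0 = 1\<close>]
    show "norm (Ut t) \<le> 1" if "t \<in> {0..T}" for t using that by blast
    show "norm (exp (r *\<^sub>R B)) \<le> 1" for r
      unfolding B_def by (rule norm_exp_skew) (rule Re_cinner_hermitian[OF herm(1)])
  qed
  also have "\<dots> \<le> C1 * (J * T) + 1/2 * (J * T) * (\<epsilon> * T)"
    using E_integral by (simp add: norms(3))
  \<comment> \<open>The left side consists of the terms n = 1, 2 of the sum; the terms n = 3, 4, 5
    are nonnegative.\<close>
  also have "\<dots> \<le> (J * T) * (\<Sum>n = 1..5. dd_const C1 n * (\<epsilon> * T) ^ (n - 1))"
  proof -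
    have "{1..5::nat} = {1, 2, 3, 4, 5}" by auto
    then have "(\<Sum>n = 1..5. dd_const C1 n * (\<epsilon> * T) ^ (n - 1))
        = C1 + 1/2 * (\<epsilon> * T) + (2/9 * (\<epsilon> * T)\<^sup>2 + 11/9 * (\<epsilon> * T) ^ 3 + 9.43 * (\<epsilon> * T) ^ 4)"
      by (simp add: dd_const_def)
    moreover
    have "0 \<le> J * T" "0 \<le> \<epsilon> * T"
      using gen.J_nonneg gen.\<beta>_nonneg T_pos by (auto simp: norms(3))
    then have "0 \<le> 2/9 * (\<epsilon> * T)\<^sup>2 + 11/9 * (\<epsilon> * T) ^ 3 + 9.43 * (\<epsilon> * T) ^ 4"
      using zero_le_power[of "\<epsilon> * T"] by (intro add_nonneg_nonneg) simp_all
    from mult_nonneg_nonneg[OF \<open>0 \<le> J * T\<close> this]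
    have "C1 * (J * T) + 1/2 * (J * T) * (\<epsilon> * T) \<le> (J * T) * (C1 + 1/2 * (\<epsilon> * T)
        + (2/9 * (\<epsilon> * T)\<^sup>2 + 11/9 * (\<epsilon> * T) ^ 3 + 9.43 * (\<epsilon> * T) ^ 4))"
      by (simp only: distrib_left mult_ac)
    ultimately show ?thesis by simp
  qed
  also have "T *\<^sub>R B = (- \<i> * t0) *\<^sub>C HB"
    by (simp add: B_def T scaleR_scaleC scaleC_scaleC mult.commute)
  finally have "norm (Ut t0 - exp ((- \<i> * t0) *\<^sub>C HB))
      \<le> (J * T) * (\<Sum>n = 1..5. dd_const C1 n * (\<epsilon> * T) ^ (n - 1))"
    by (simp only: T)
  with first orders tail show ?thesis by blast
qed

end
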